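(* Suppose an optimal occupation measure $(x_t(s,a))_{t\in[T],s\in S,a\in A}$ is non-degenerate. Then for any priority-score functions $\{\mathcal{P}_t\}_{t\in[T]}$, the corresponding fluid-priority policy $\pi_F$ satisfies $$\hat V_N^*-V_N(\pi_F)\le m,$$ where $m$ is a constant not depending on $N$.
   Context: Model. Fix, independently of $N$: a finite set $S$ (single-arm states), $A=\{0,1\}$ ($1$ = pull, $0$ = idle), a horizon $T$, $[T]=\{1,\dots,T\}$, transition kernels $p_t(s,a,s')$, rewards $r_t:S\times A\to\mathbb{R}$, rational budget ratios $\alpha_t\in[0,1]$, and an initial state $s^*\in S$. $N$ ranges over positive integers for which $\alpha_t N$ is an integer for all $t\in[T]$. There are $N$ arms, all in state $s^*$ at time $1$. At each time $t\in[T]$ every arm $i$ with state $s_{t,i}$ receives an action $a_{t,i}\in A$ chosen based on the current states and $t$; then, conditionally independently across arms, arm $i$ moves to state $s'$ with probability $p_t(s_{t,i},a_{t,i},s')$. The total reward at time $t$ is $R_t=\sum_{i=1}^N r_t(s_{t,i},a_{t,i})$. The budget constraint requires that exactly $\alpha_tN$ arms are pulled at each time $t$. Let $Z^N_t(s)$ be the number of arms in state $s$ at time $t$ and $X^N_t(s,a)$ the number of arms in state $s$ to which action $a$ is applied at time $t$. A policy $\pi$ is identified with maps (for each $N$ and $t$) $Z^N_t\mapsto X^N_t=\pi(t,Z^N_t)$ with $\sum_{a}X^N_t(s,a)=Z^N_t(s)$ and $\sum_s X^N_t(s,1)=\alpha_tN$. Its value is $V_N(\pi)=\mathbb{E}_\pi\sum_{t=1}^T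 R_t$. Optimal occupation measure. A solution $x=(x_t(s,a))_{t\in[T],s\in S,a\in A}$ of the linear program: maximize $\sum_{t=1}^T\sum_{s,a} r_t(s,a)x_t(s,a)$ subject to $\sum_a x_t(s,a)=\sum_{a}\sum_{s'} x_{t-1}(s',a)p_{t-1}(s',a,s)$ for all $s\in S$, $2\le t\le T$; $\sum_s x_t(s,1)=\alpha_t$ for $t\in[T]$; $\sum_a x_1(s^*,a)=1$; $\sum_{s,a}x_1(s,a)=1$; $x_t(s,a)\ge 0$. Relaxed value. $\hat V_N^*$ is the maximum of $\mathbb{E}_\pi\sum_{t=1}^TR_t$ over (possibly randomized) policies for the $N$ arms when the budget constraint is replaced by the constraint that the expected number of arms pulled at time $t$ equals $\alpha_tN$ for all $t\in[T]$. It equals $N\hat V_1^*$, where $\hat V_1^*$ is the optimal value of the linear program above. Fluid-priority policy. Given an optimal occupation measure $x$ and priority-score functions $\mathcal{P}_t:S\to\mathbb{R}$, $t\in[T]$, set $C^+_t=\{s: x_t(s,1)>0,\ x_t(s,0)=0\}$ (fluid-active), $C^0_t=\{s:x_t(s,1)>0,\ x_t(s,0)>0\}$ (fluid-neutral), $C^-_t=\{s:x_t(s,1)=0\}$ (fluid-inactive). At time $t$, given counts $Z(s)$, start with $B=\alpha_tN$; in each of the following passes states are visited in decreasing order of $\mathcal{P}_t$ (ties broken in a fixed arbitrary way). (i) For $s\in C^+_t$: $X(s,1)\leftarrow\min\{B,Z(s)\}$, $B\leftarrow B-X(s,1)$. (ii) For $s\in C^0_t$: $X(s,1)\leftarrow\min\{B,Z(s),\lfloor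 Nx_t(s,1)\rfloor\}$, $U(s)\leftarrow Z(s)-X(s,1)$, $B\leftarrow B-X(s,1)$. (iii) For $s\in C^0_t$: let $m'=\min\{B,U(s)\}$; $X(s,1)\leftarrow X(s,1)+m'$, $B\leftarrow B-m'$. (iv) For $s\in C^-_t$: $X(s,1)\leftarrow\min\{B,Z(s)\}$, $B\leftarrow B-X(s,1)$. Finally $X(s,0)=Z(s)-X(s,1)$ and $\pi_F(t,Z)=X$. Non-degeneracy. An optimal occupation measure is non-degenerate if $|C^0_t|\ge1$ for all $t\in[T]$. *)

theory Defs
  imports "HOL-Probability.Probability"
begin

text \<open>
  The set of single-arm states is a finite type; the action \<^term>\<open>True\<close> means pull, \<^term>\<open>False\<close> means
  idle.  Times run from \<open>1\<close> to the horizon; values of the time-indexed components outside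
  this range are irrelevant.
\<close>

record 's bandit =
  horizon :: nat
  kernel :: "nat \<Rightarrow> 's \<Rightarrow> bool \<Rightarrow> 's pmf"
  reward :: "nat \<Rightarrow> 's \<Rightarrow> bool \<Rightarrow> real"
  ratio :: "nat \<Rightarrow> real"
  init :: 's

definition epochs :: "'s bandit \<Rightarrow> nat set" where
  "epochs M = {1..horizon M}"

definition valid_ratios :: "'s bandit \<Rightarrow> bool" where
  "valid_ratios M \<longleftrightarrow> (\<forall>t\<in>epochs M. ratio M t \<in> \<rat> \<and> 0 \<le> ratio M t \<and> ratio M t \<le> 1)"

definition admissible_size :: "'s bandit \<Rightarrow> nat \<Rightarrow> bool" where
  "admissible_size M N \<longleftrightarrow> 0 < N \<and> (\<forall>t\<in>epochs M. ratio M t * real N \<in> \<int>)"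

text \<open>For an admissible number of arms the floor below is exact.\<close>

definition budget :: "'s bandit \<Rightarrow> nat \<Rightarrow> nat \<Rightarrow> nat" where
  "budget M N t = nat \<lfloor>ratio M t * real N\<rfloor>"


section \<open>The system of \<open>N\<close> arms\<close>

text \<open>
  The arms are the indices \<open>i < N\<close>; the entries of a state or action vector
  at other indices carry no information.
\<close>

type_synonym 's arm_policy = "nat \<Rightarrow> (nat \<Rightarrow> 's) \<Rightarrow> (nat \<Rightarrow> bool) pmf"

text \<open>
  \<open>trajectory M N \<phi> k\<close> is the joint law of the state vectors at times \<open>1, \<dots>, k + 1\<close>
  and of the action vectors at times \<open>1, \<dots>, k\<close>; all other entries are dummies.
\<close>

primrec trajectory ::
  "'s bandit \<Rightarrow> nat \<Rightarrow> 's arm_policy \<Rightarrow> nat \<Rightarrow> ((nat \<Rightarrow> nat \<Rightarrow> 's) \<times> (nat \<Rightarrow> nat \<Rightarrow> bool)) pmf"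
where
  "trajectory M N \<phi> 0 = return_pmf (\<lambda>_ _. init M, \<lambda>_ _. False)"
| "trajectory M N \<phi> (Suc k) = do {
     (\<sigma>, \<rho>) \<leftarrow> trajectory M N \<phi> k;
     a \<leftarrow> \<phi> (Suc k) (\<sigma> (Suc k));
     s' \<leftarrow> Pi_pmf {..<N} (init M) (\<lambda>i. kernel M (Suc k) (\<sigma> (Suc k) i) (a i));
     return_pmf (\<sigma>(Suc (Suc k) := s'), \<rho>(Suc k := a))
   }"

definition arm_value :: "'s bandit \<Rightarrow> nat \<Rightarrow> 's arm_policy \<Rightarrow> real" where
  "arm_value M N \<phi> = measure_pmf.expectation (trajectory M N \<phi> (horizon M))
     (\<lambda>(\<sigma>, \<rho>). \<Sum>t\<in>epochs M. \<Sum>i<N. reward M t (\<sigma> t i) (\<rho> t i))"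

definition relaxed_policy :: "'s bandit \<Rightarrow> nat \<Rightarrow> 's arm_policy \<Rightarrow> bool" where
  "relaxed_policy M N \<phi> \<longleftrightarrow> (\<forall>t\<in>epochs M.
     measure_pmf.expectation (trajectory M N \<phi> (horizon M)) (\<lambda>(\<sigma>, \<rho>). real (card {i. i < N \<and> \<rho> t i}))
       = ratio M t * real N)"

text \<open>
  For an admissible number of arms the supremum below ranges over a nonempty bounded set of reals:
  pulling the first \<open>ratio M t * N\<close> arms is a relaxed policy, and rewards are bounded.
\<close>

definition relaxed_value :: "'s bandit \<Rightarrow> nat \<Rightarrow> real" where
  "relaxed_value M N = (SUP \<phi>\<in>{\<phi>. relaxed_policy M N \<phi>}. arm_value M N \<phi>)"


section \<open>Policies on counts\<close>

type_synonym 's count_policy = "nat \<Rightarrow> ('s \<Rightarrow> nat) \<Rightarrow> 's \<Rightarrow> bool \<Rightarrow> nat"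

definition state_count :: "nat \<Rightarrow> (nat \<Rightarrow> 's) \<Rightarrow> 's \<Rightarrow> nat" where
  "state_count N \<sigma> s = card {i. i < N \<and> \<sigma> i = s}"

definition action_count :: "nat \<Rightarrow> (nat \<Rightarrow> 's) \<Rightarrow> (nat \<Rightarrow> bool) \<Rightarrow> 's \<Rightarrow> bool \<Rightarrow> nat" where
  "action_count N \<sigma> a s b = card {i. i < N \<and> \<sigma> i = s \<and> a i = b}"

definition valid_count_policy :: "'s::finite bandit \<Rightarrow> nat \<Rightarrow> 's count_policy \<Rightarrow> bool" where
  "valid_count_policy M N \<pi> \<longleftrightarrow> (\<forall>t\<in>epochs M. \<forall>Z. (\<Sum>s\<in>UNIV. Z s) = N \<longrightarrow>
     (\<forall>s. (\<Sum>b\<in>UNIV. \<pi> t Z s b) = Z s) \<and> (\<Sum>s\<in>UNIV. \<pi> t Z s True) = budget M N t)"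

text \<open>
  A policy on counts fixes how many arms in each state receive each action, but not which ones.
  The arm-level policies compatible with it are those whose action counts always are the
  prescribed ones; the arms to be pulled within a state may be picked in any
  (even randomized) way.
\<close>

definition realizes :: "'s bandit \<Rightarrow> nat \<Rightarrow> 's count_policy \<Rightarrow> 's arm_policy \<Rightarrow> bool" where
  "realizes M N \<pi> \<phi> \<longleftrightarrow> (\<forall>t\<in>epochs M. \<forall>\<sigma>. \<forall>a\<in>set_pmf (\<phi> t \<sigma>).
     action_count N \<sigma> a = \<pi> t (state_count N \<sigma>))"


section \<open>Occupation measures\<close>

type_synonym 's occupation = "nat \<Rightarrow> 's \<Rightarrow> bool \<Rightarrow> real"

definition feasible_occupation :: "'s::finite bandit \<Rightarrow> 's occupation \<Rightarrow> bool" where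
  "feasible_occupation M x \<longleftrightarrow>
     (\<forall>t\<in>{2..horizon M}. \<forall>s. (\<Sum>a\<in>UNIV. x t s a) =
        (\<Sum>a\<in>UNIV. \<Sum>s'\<in>UNIV. x (t - 1) s' a * pmf (kernel M (t - 1) s' a) s)) \<and>
     (\<forall>t\<in>epochs M. (\<Sum>s\<in>UNIV. x t s True) = ratio M t) \<and>
     (\<Sum>a\<in>UNIV. x 1 (init M) a) = 1 \<and>
     (\<Sum>s\<in>UNIV. \<Sum>a\<in>UNIV. x 1 s a) = 1 \<and>
     (\<forall>t\<in>epochs M. \<forall>s a. 0 \<le> x t s a)"

definition occupation_reward :: "'s::finite bandit \<Rightarrow> 's occupation \<Rightarrow> real" where
  "occupation_reward M x = (\<Sum>t\<in>epochs M. \<Sum>s\<in>UNIV. \<Sum>a\<in>UNIV. reward M t s a * x t s a)"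

definition optimal_occupation :: "'s::finite bandit \<Rightarrow> 's occupation \<Rightarrow> bool" where
  "optimal_occupation M x \<longleftrightarrow> feasible_occupation M x \<and>
     (\<forall>y. feasible_occupation M y \<longrightarrow> occupation_reward M y \<le> occupation_reward M x)"

definition fluid_active :: "'s occupation \<Rightarrow> nat \<Rightarrow> 's set" where
  "fluid_active x t = {s. 0 < x t s True \<and> x t s False = 0}"

definition fluid_neutral :: "'s occupation \<Rightarrow> nat \<Rightarrow> 's set" where
  "fluid_neutral x t = {s. 0 < x t s True \<and> 0 < x t s False}"

definition fluid_inactive :: "'s occupation \<Rightarrow> nat \<Rightarrow> 's set" where
  "fluid_inactive x t = {s. x t s True = 0}"

definition nondegenerate :: "'s::finite bandit \<Rightarrow> 's occupation \<Rightarrow> bool" where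
  "nondegenerate M x \<longleftrightarrow> (\<forall>t\<in>epochs M. 1 \<le> card (fluid_neutral x t))"


section \<open>Fluid-priority policies\<close>

text \<open>
  A visiting order lists all states by decreasing priority score; the choice of the list
  is the choice of the tie-breaking rule.
\<close>

definition visiting_order :: "('s \<Rightarrow> real) \<Rightarrow> 's list \<Rightarrow> bool" where
  "visiting_order P L \<longleftrightarrow> distinct L \<and> set L = UNIV \<and> sorted_wrt (\<lambda>s s'. P s \<ge> P s') L"

text \<open>
  One pass with remaining budget \<open>B\<close> and pull counts \<open>X\<close> over the states in \<open>C\<close>: each visited
  state's pull count is raised towards the target \<open>cap s\<close> as far as the remaining budget permits.
  A state not visited in an earlier pass has pull count \<open>0\<close>, and then the new pull count is
  \<open>min B (cap s)\<close>; in pass (iii), \<open>Z s - X s\<close> is the number \<open>U s\<close> of arms left over by pass (ii).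
\<close>

definition priority_pass ::
  "'s list \<Rightarrow> 's set \<Rightarrow> ('s \<Rightarrow> nat) \<Rightarrow> nat \<times> ('s \<Rightarrow> nat) \<Rightarrow> nat \<times> ('s \<Rightarrow> nat)"
where
  "priority_pass L C cap =
     fold (\<lambda>s (B, X). let m = min B (cap s - X s) in (B - m, X(s := X s + m)))
       (filter (\<lambda>s. s \<in> C) L)"

definition fluid_priority_pulls ::
  "'s bandit \<Rightarrow> 's occupation \<Rightarrow> (nat \<Rightarrow> 's list) \<Rightarrow> nat \<Rightarrow> nat \<Rightarrow> ('s \<Rightarrow> nat) \<Rightarrow> 's \<Rightarrow> nat"
where
  "fluid_priority_pulls M x L N t Z =
    (let q0 = (budget M N t, \<lambda>_. 0);
         q1 = priority_pass (L t) (fluid_active x t) Z q0;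
         q2 = priority_pass (L t) (fluid_neutral x t)
                (\<lambda>s. min (Z s) (nat \<lfloor>real N * x t s True\<rfloor>)) q1;
         q3 = priority_pass (L t) (fluid_neutral x t) Z q2;
         q4 = priority_pass (L t) (fluid_inactive x t) Z q3
     in snd q4)"

definition fluid_priority ::
  "'s bandit \<Rightarrow> 's occupation \<Rightarrow> (nat \<Rightarrow> 's list) \<Rightarrow> nat \<Rightarrow> 's count_policy"
where
  "fluid_priority M x L N t Z s b =
    (if b then fluid_priority_pulls M x L N t Z s else Z s - fluid_priority_pulls M x L N t Z s)"


section \<open>Sanity checks\<close>

text \<open>
  The fluid-priority policy conserves arms and spends the budget exactly, and every
  policy on counts with these properties has an arm-level realization.
\<close>

lemma priority_pass_induct:
  fixes X :: "'s::finite \<Rightarrow> nat"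
  assumes "priority_pass L C cap (B, X) = (B', X')" and "\<forall>s. X s \<le> Z s" and "\<forall>s. cap s \<le> Z s"
  shows "B' + sum X' UNIV = B + sum X UNIV \<and> (\<forall>s. X s \<le> X' s \<and> X' s \<le> Z s) \<and>
    (0 < B' \<longrightarrow> (\<forall>s\<in>C \<inter> set L. cap s \<le> X' s))"
  using assms
proof (induction L arbitrary: B X)
  case Nil
  then show ?case by (simp add: priority_pass_def)
next
  case (Cons u L)
  show ?case
  proof (cases "u \<in> C")
    case False
    then show ?thesis using Cons by (auto simp: priority_pass_def)
  next
    case True
    define m where "m = min B (cap u - X u)"
    define Y where "Y = X(u := X u + m)"
    have eq: "priority_pass L C cap (B - m, Y) = (B', X')"
      using Cons.prems(1) True by (simp add: priority_pass_def m_def Y_def Let_def)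
    have "sum Y UNIV = sum X UNIV + m"
      unfolding Y_def by (simp add: sum.remove[of UNIV u])
    moreover have "m \<le> B" by (simp add: m_def)
    moreover have "X u + m \<le> Z u"
      using Cons.prems(2,3)[rule_format, of u] by (simp add: m_def)
    then have Yle: "\<forall>s. Y s \<le> Z s" using Cons.prems(2) by (simp add: Y_def)
    have ih: "B' + sum X' UNIV = B - m + sum Y UNIV \<and> (\<forall>s. Y s \<le> X' s \<and> X' s \<le> Z s) \<and>
      (0 < B' \<longrightarrow> (\<forall>s\<in>C \<inter> set L. cap s \<le> X' s))"
      by (rule Cons.IH[OF eq Yle Cons.prems(3)])
    moreover have XY: "X s \<le> Y s" for s by (simp add: Y_def)
    moreover have "cap u \<le> X' u" if "0 < B'"
    proof -
      have "B' \<le> B - m"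
        using ih sum_mono[of UNIV Y X'] by simp
      then have "m = cap u - X u" using that by (simp add: m_def min_def split: if_splits)
      then have "cap u \<le> Y u" by (simp add: Y_def)
      then show ?thesis using ih le_trans by blast
    qed
    ultimately show ?thesis by (auto intro: le_trans[OF XY])
  qed
qed

lemma fluid_priority_valid:
  fixes M :: "'s::finite bandit"
  assumes "valid_ratios M" and "admissible_size M N" and "feasible_occupation M x"
    and L: "\<forall>t\<in>epochs M. visiting_order (P t) (L t)"
  shows "valid_count_policy M N (fluid_priority M x L N)"
  unfolding valid_count_policy_def
proof (intro ballI allI impI)
  fix t :: nat and Z :: "'s \<Rightarrow> nat"
  assume t: "t \<in> epochs M" and Z: "(\<Sum>s\<in>UNIV. Z s) = N"
  let ?c2 = "\<lambda>s::'s. min (Z s) (nat \<lfloor>real N * x t s True\<rfloor>)"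
  obtain B1 X1 where 1: "priority_pass (L t) (fluid_active x t) Z (budget M N t, \<lambda>_. 0) = (B1, X1)"
    by fastforce
  obtain B2 X2 where 2: "priority_pass (L t) (fluid_neutral x t) ?c2 (B1, X1) = (B2, X2)"
    by fastforce
  obtain B3 X3 where 3: "priority_pass (L t) (fluid_neutral x t) Z (B2, X2) = (B3, X3)"
    by fastforce
  obtain B4 X4 where 4: "priority_pass (L t) (fluid_inactive x t) Z (B3, X3) = (B4, X4)"
    by fastforce
  have X: "fluid_priority_pulls M x L N t Z = X4"
    by (simp add: fluid_priority_pulls_def 1 2 3 4)
  note p1 = priority_pass_induct[OF 1, where Z = Z, simplified]
  have p2: "B2 + sum X2 UNIV = B1 + sum X1 UNIV" "\<forall>s. X1 s \<le> X2 s" "\<forall>s. X2 s \<le> Z s"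
    using priority_pass_induct[OF 2, where Z = Z] p1 by auto
  have p3: "B3 + sum X3 UNIV = B2 + sum X2 UNIV" "\<forall>s. X2 s \<le> X3 s" "\<forall>s. X3 s \<le> Z s"
    "0 < B3 \<Longrightarrow> \<forall>s\<in>fluid_neutral x t \<inter> set (L t). Z s \<le> X3 s"
    using priority_pass_induct[OF 3, where Z = Z] p2 by auto
  have p4: "B4 + sum X4 UNIV = B3 + sum X3 UNIV" "\<forall>s. X3 s \<le> X4 s" "\<forall>s. X4 s \<le> Z s"
    "0 < B4 \<Longrightarrow> \<forall>s\<in>fluid_inactive x t \<inter> set (L t). Z s \<le> X4 s"
    using priority_pass_induct[OF 4, where Z = Z] p3 by auto
  have total: "B4 + sum X4 UNIV = budget M N t" using p1 p2 p3 p4 by simp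
  have bN: "budget M N t \<le> N"
  proof -
    have "ratio M t * real N \<le> 1 * real N"
      using assms(1) t by (intro mult_right_mono) (auto simp: valid_ratios_def)
    then show ?thesis unfolding budget_def by linarith
  qed
  have "B4 = 0"
  proof (rule ccontr)
    assume "B4 \<noteq> 0"
    then have b4: "0 < B4" by simp
    have "sum X3 UNIV \<le> sum X4 UNIV" "sum X2 UNIV \<le> sum X3 UNIV" "sum X1 UNIV \<le> sum X2 UNIV"
      using p2 p3 p4 by (auto intro: sum_mono)
    then have b3: "0 < B3" and b1: "0 < B1" using p2 p3 p4 b4 by auto
    have "Z s \<le> X4 s" for s
    proof -
      have "s \<in> set (L t)" using L t by (auto simp: visiting_order_def)
      moreover have "0 \<le> x t s True" "0 \<le> x t s False"
        using assms(3) t by (auto simp: feasible_occupation_def)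
      then have "s \<in> fluid_active x t \<or> s \<in> fluid_neutral x t \<or> s \<in> fluid_inactive x t"
        by (auto simp: fluid_active_def fluid_neutral_def fluid_inactive_def)
      ultimately show ?thesis
        using p1 p2(2) p3(2,4) p4(2,4) b1 b3 b4 by (meson IntI le_trans)
    qed
    then have "N \<le> sum X4 UNIV" using Z sum_mono[of UNIV Z X4] by simp
    then show False using total bN b4 by simp
  qed
  then show "(\<forall>s. (\<Sum>b\<in>UNIV. fluid_priority M x L N t Z s b) = Z s) \<and>
    (\<Sum>s\<in>UNIV. fluid_priority M x L N t Z s True) = budget M N t"
    using total p4(3) by (simp add: fluid_priority_def X UNIV_bool)
qed

lemma state_count_sum: "(\<Sum>s\<in>UNIV. state_count N \<sigma> s) = N" for \<sigma> :: "nat \<Rightarrow> 's::finite"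
proof -
  have "card {..<N} = (\<Sum>s\<in>UNIV. card {i \<in> {..<N}. \<sigma> i = s})"
    using sum.group[of "{..<N}" "UNIV" \<sigma> "\<lambda>_. 1::nat"] by simp
  then show ?thesis by (simp add: state_count_def)
qed

lemma realization_exists:
  fixes M :: "'s::finite bandit"
  assumes "valid_count_policy M N \<pi>"
  shows "\<exists>\<phi>. realizes M N \<pi> \<phi>"
proof -
  have ex: "\<exists>a. action_count N \<sigma> a = \<pi> t (state_count N \<sigma>)" if t: "t \<in> epochs M" for t \<sigma>
  proof -
    let ?Z = "state_count N \<sigma>"
    let ?A = "\<lambda>s. {i. i < N \<and> \<sigma> i = s}"
    have split: "\<pi> t ?Z s False + \<pi> t ?Z s True = card (?A s)" for s
      using assms t state_count_sum[of N \<sigma>]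
      by (simp add: valid_count_policy_def UNIV_bool state_count_def)
    have "\<exists>D. D \<subseteq> ?A s \<and> card D = \<pi> t ?Z s True" for s
      using obtain_subset_with_card_n[of "\<pi> t ?Z s True" "?A s"] split[of s] by (metis le_add2)
    then obtain D where D: "\<And>s. D s \<subseteq> ?A s" "\<And>s. card (D s) = \<pi> t ?Z s True" by metis
    let ?a = "\<lambda>i. i \<in> D (\<sigma> i)"
    have "action_count N \<sigma> ?a s b = \<pi> t ?Z s b" for s b
    proof (cases b)
      case True
      have "{i. i < N \<and> \<sigma> i = s \<and> i \<in> D (\<sigma> i)} = D s" using D(1)[of s] by auto
      then show ?thesis using True D(2) by (simp add: action_count_def)
    next
      case False
      have "{i. i < N \<and> \<sigma> i = s \<and> i \<notin> D (\<sigma> i)} = ?A s - D s" by auto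
      moreover have "card (?A s - D s) = card (?A s) - card (D s)"
        using D(1)[of s] by (intro card_Diff_subset) (auto intro: finite_subset)
      ultimately show ?thesis using False D(2)[of s] split[of s] by (simp add: action_count_def)
    qed
    then show ?thesis by blast
  qed
  define \<phi> where "\<phi> = (\<lambda>t \<sigma>. return_pmf (SOME a. action_count N \<sigma> a = \<pi> t (state_count N \<sigma>)))"
  have "realizes M N \<pi> \<phi>"
    unfolding realizes_def \<phi>_def using someI_ex[OF ex] by simp
  then show ?thesis by blast
qed

end

theory Submission
  imports Defs
begin

text \<open>
  The loss of a policy is a matter of its mean occupation measure only.  For every policy on \<open>N\<close>
  arms, the expected number of arms in state \<open>s\<close> receiving action \<open>b\<close> at time \<open>t\<close>, divided by \<open>N\<close>,
  satisfies all constraints of the linear program except possibly the budget, and the budget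
  as well if the policy is relaxed (lemma \<open>mean_occupation_feasible\<close>).  The value of the policy is \<open>N\<close>
  times the objective at this point.  Hence the relaxed value is at most \<open>N\<close> times the optimum, and
  the task is to show that the mean occupation \<open>y\<close> of the fluid-priority policy is within
  \<open>O(1/N)\<close> of the optimum \<open>x\<close> in the objective, although \<open>y\<close> itself may differ from \<open>x\<close> by more.

  The objective does not change along directions \<open>w\<close> that respect the equality constraints and vanish
  wherever \<open>x\<close> vanishes, since \<open>x + e * w\<close> and \<open>x - e * w\<close> are then both feasible for small \<open>e\<close>.
  By linear algebra the loss of any feasible \<open>y\<close> is therefore at most a constant times the mass that
  \<open>y\<close> puts on pairs \<open>(s, b)\<close> with \<open>x t s b = 0\<close> (lemma \<open>optimal_occupation_sensitivity\<close>); this is the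
  part of linear programming duality that the theorem rests on.  So it suffices that the fluid-priority
  policy applies an action unused by \<open>x\<close> to only \<open>O(1)\<close> arms in expectation.

  Pulling a fluid-inactive arm or idling a fluid-active one requires the state counts to be off
  their fluid values by \<open>\<delta> * N\<close>, where \<open>\<delta> > 0\<close> measures the mass of the fluid-neutral states: these
  absorb every smaller deviation, and this is where non-degeneracy enters.  At most \<open>N\<close> arms
  are misplaced in that case, so their number is at most \<open>d\<^sup>2 / (\<delta>\<^sup>2 * N)\<close> for a deviation \<open>d\<close> (lemma
  \<open>misplaced_arms_bound\<close>).  The mean of \<open>d\<^sup>2\<close> is \<open>O(N)\<close> by induction over time (lemma
  \<open>deviation_moment_bound\<close>), because each transition adds independent noise of variance \<open>O(N)\<close>, and
  the action counts deviate from \<open>N * x\<close> by at most a constant times \<open>d\<close> plus a constant for the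
  roundings (lemma \<open>pulls_near_fluid\<close>).  The remaining unused pairs are in states that the fluid never
  occupies; arms get there only through an unused action one step earlier, so that a
  second induction over time bounds their number (lemma \<open>unused_mass_bound\<close>).
\<close>

section \<open>Sensitivity of the linear program at an optimum\<close>

definition linear_functional :: "(('i \<Rightarrow> real) \<Rightarrow> real) \<Rightarrow> bool" where
  "linear_functional f \<longleftrightarrow> (\<forall>u v c. f (\<lambda>i. u i + c * v i) = f u + c * f v)"

text \<open>
  A functional that vanishes on the common kernel of finitely many others is a linear combination of
  them; the constant \<open>K\<close> is the sum of the absolute values of the coefficients.  In the induction step,
  a vector \<open>v0\<close> killed by \<open>G\<close> but not by \<open>g\<close> determines the coefficient of \<open>g\<close>; without such a
  vector, \<open>g\<close> adds nothing to the span of \<open>G\<close>.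
\<close>
lemma bounded_by_functionals_with_smaller_kernel:
  fixes f :: "('i \<Rightarrow> real) \<Rightarrow> real"
  assumes "finite G" and "linear_functional f" and "\<forall>g\<in>G. linear_functional g"
    and "\<And>v. \<forall>g\<in>G. g v = 0 \<Longrightarrow> f v = 0"
  shows "\<exists>K. \<forall>v B. (\<forall>g\<in>G. \<bar>g v\<bar> \<le> B) \<longrightarrow> \<bar>f v\<bar> \<le> K * B"
  using assms
proof (induction G arbitrary: f rule: finite_induct)
  case empty
  then show ?case by (intro exI[of _ 0]) simp
next
  case (insert g G)
  have lin: "h (\<lambda>i. u i + c * v i) = h u + c * h v" if "h = f \<or> h \<in> insert g G" for h u v c
    using insert.prems(1,2) that unfolding linear_functional_def by blast
  show ?case
  proof (cases "\<exists>v. (\<forall>h\<in>G. h v = 0) \<and> g v \<noteq> 0")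
    case True
    then obtain v0 where v0: "\<forall>h\<in>G. h v0 = 0" "g v0 \<noteq> 0" by blast
    \<comment> \<open>the coefficient for which \<open>f - c * g\<close> vanishes at \<open>v0\<close>\<close>
    define c where "c = f v0 / g v0"
    have "\<exists>K. \<forall>v B. (\<forall>h\<in>G. \<bar>h v\<bar> \<le> B) \<longrightarrow> \<bar>f v - c * g v\<bar> \<le> K * B"
    proof (rule insert.IH)
      show "linear_functional (\<lambda>v. f v - c * g v)"
        unfolding linear_functional_def by (simp add: lin algebra_simps)
      show "\<forall>h\<in>G. linear_functional h" using insert.prems by blast
      fix v assume v: "\<forall>h\<in>G. h v = 0"
      have "f (\<lambda>i. v i + (- (g v / g v0)) * v0 i) = 0"
      proof (rule insert.prems(3), intro ballI)
        fix h assume "h \<in> insert g G"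
        then show "h (\<lambda>i. v i + (- (g v / g v0)) * v0 i) = 0"
          using v v0 by (subst lin) auto
      qed
      then show "f v - c * g v = 0"
        by (subst (asm) lin) (simp_all add: c_def)
    qed
    then obtain K where K: "\<And>v B. \<forall>h\<in>G. \<bar>h v\<bar> \<le> B \<Longrightarrow> \<bar>f v - c * g v\<bar> \<le> K * B" by blast
    have "\<bar>f v\<bar> \<le> (K + \<bar>c\<bar>) * B" if "\<forall>h\<in>insert g G. \<bar>h v\<bar> \<le> B" for v B
    proof -
      have "\<bar>f v - c * g v\<bar> \<le> K * B" using K that by blast
      moreover have "\<bar>c * g v\<bar> \<le> \<bar>c\<bar> * B"
        using that by (simp add: abs_mult mult_left_mono)
      ultimately show ?thesis by (simp add: algebra_simps)
    qed
    then show ?thesis by blast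
  next
    case False
    have "\<exists>K. \<forall>v B. (\<forall>h\<in>G. \<bar>h v\<bar> \<le> B) \<longrightarrow> \<bar>f v\<bar> \<le> K * B"
      using insert.prems False by (intro insert.IH) auto
    then show ?thesis by auto
  qed
qed

text \<open>
  Moving from \<open>x\<close> a little in a direction that keeps the equality constraints and the zeros of \<open>x\<close>
  stays feasible and so cannot gain; the same holds for the opposite direction.  The reward therefore
  vanishes on the common kernel of the constraint functionals and of the coordinates in which \<open>x\<close>
  is \<open>0\<close>.  On \<open>y - x\<close> the constraint functionals vanish, and these coordinates are those of \<open>y\<close>.
\<close>
lemma optimal_occupation_sensitivity:
  fixes M :: "'s::finite bandit"
  assumes opt: "optimal_occupation M x" and T: "1 \<le> horizon M"
  shows "\<exists>K. \<forall>y B. feasible_occupation M y \<longrightarrow> 0 \<le> B \<longrightarrow>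
    (\<forall>t\<in>epochs M. \<forall>s a. x t s a = 0 \<longrightarrow> y t s a \<le> B) \<longrightarrow>
    occupation_reward M x - occupation_reward M y \<le> K * B"
proof -
  define f :: "(nat \<times> 's \<times> bool \<Rightarrow> real) \<Rightarrow> real" where
    "f w = (\<Sum>t\<in>epochs M. \<Sum>s\<in>UNIV. \<Sum>a\<in>UNIV. reward M t s a * w (t, s, a))" for w
  define flow :: "nat \<Rightarrow> 's \<Rightarrow> (nat \<times> 's \<times> bool \<Rightarrow> real) \<Rightarrow> real" where
    "flow t s w = (\<Sum>a\<in>UNIV. w (t, s, a)) -
       (\<Sum>a\<in>UNIV. \<Sum>s'\<in>UNIV. w (t - 1, s', a) * pmf (kernel M (t - 1) s' a) s)" for t s w
  define pulls :: "nat \<Rightarrow> (nat \<times> 's \<times> bool \<Rightarrow> real) \<Rightarrow> real" where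
    "pulls t w = (\<Sum>s\<in>UNIV. w (t, s, True))" for t w
  define start :: "(nat \<times> 's \<times> bool \<Rightarrow> real) \<Rightarrow> real" where
    "start w = (\<Sum>a\<in>UNIV. w (1, init M, a))" for w
  define total :: "(nat \<times> 's \<times> bool \<Rightarrow> real) \<Rightarrow> real" where
    "total w = (\<Sum>s\<in>UNIV. \<Sum>a\<in>UNIV. w (1, s, a))" for w
  define Z where "Z = {(t, s, a). t \<in> epochs M \<and> x t s a = 0}"
  define G where "G = (\<lambda>(t, s). flow t s) ` ({2..horizon M} \<times> UNIV) \<union> pulls ` epochs M \<union>
    {start, total} \<union> (\<lambda>i w. w i) ` Z"
  note defs = f_def flow_def pulls_def start_def total_def
  have feas: "feasible_occupation M x" using opt by (simp add: optimal_occupation_def)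
  have fin_ep: "finite (epochs M)" by (simp add: epochs_def)
  have one: "1 \<in> epochs M" using T by (simp add: epochs_def)
  have "finite Z"
    by (rule finite_subset[of _ "epochs M \<times> UNIV"]) (auto simp: Z_def fin_ep)
  then have "finite G" unfolding G_def by (simp add: fin_ep)
  have lin: "linear_functional f" "linear_functional (flow t s)" "linear_functional (pulls t)"
    "linear_functional start" "linear_functional total" "linear_functional (\<lambda>w. w i)" for t s i
    unfolding linear_functional_def defs
    by (simp_all add: algebra_simps sum.distrib sum_distrib_left)
  have linG: "\<forall>g\<in>G. linear_functional g"
    using lin unfolding G_def by auto
  have one_sided: "f w \<le> 0" if w: "\<forall>g\<in>G. g w = 0" for w
  proof -
    have "eventually (\<lambda>e. 0 \<le> x t s a + e * w (t, s, a)) (at_right 0)"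
      if "t \<in> epochs M" for t s a
    proof (cases "x t s a = 0")
      case True
      then have "(t, s, a) \<in> Z" using that by (simp add: Z_def)
      then have "(\<lambda>w. w (t, s, a)) \<in> G" unfolding G_def by blast
      from bspec[OF w this] have "w (t, s, a) = 0" .
      then show ?thesis using True by simp
    next
      case False
      then have "0 < x t s a"
        using feas that by (simp add: feasible_occupation_def order_less_le)
      moreover have "((\<lambda>e. x t s a + e * w (t, s, a)) \<longlongrightarrow> x t s a + 0 * w (t, s, a)) (at_right 0)"
        by (intro tendsto_intros)
      ultimately have "eventually (\<lambda>e. 0 < x t s a + e * w (t, s, a)) (at_right 0)"
        by (intro order_tendstoD(1)[where y = "x t s a"]) auto
      then show ?thesis by (rule eventually_mono) simp
    qed
    then have "\<forall>i\<in>epochs M \<times> UNIV \<times> UNIV. eventually (\<lambda>e. 0 \<le> (case i of (t, s, a) \<Rightarrow>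
        x t s a + e * w (t, s, a))) (at_right 0)"
      by auto
    then have "eventually (\<lambda>e. \<forall>i\<in>epochs M \<times> UNIV \<times> UNIV. 0 \<le> (case i of (t, s, a) \<Rightarrow>
        x t s a + e * w (t, s, a))) (at_right 0)"
      by (rule eventually_ball_finite[rotated]) (simp add: fin_ep)
    then have "eventually (\<lambda>e::real. (\<forall>i\<in>epochs M \<times> UNIV \<times> UNIV. 0 \<le> (case i of (t, s, a) \<Rightarrow>
        x t s a + e * w (t, s, a))) \<and> 0 < e) (at_right 0)"
      by (rule eventually_conj) (simp add: eventually_at_right_less)
    then obtain e :: real where e: "0 < e"
      "\<forall>t\<in>epochs M. \<forall>s a. 0 \<le> x t s a + e * w (t, s, a)"
      by (auto dest!: eventually_happens'[OF trivial_limit_at_right_real])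
    have flow0: "flow t s w = 0" if "t \<in> {2..horizon M}" for t s
      using w that unfolding G_def by force
    have pulls0: "pulls t w = 0" if "t \<in> epochs M" for t
      using w that unfolding G_def by blast
    have init0: "start w = 0" "total w = 0" using w unfolding G_def by simp_all
    let ?y = "\<lambda>t s a. x t s a + e * w (t, s, a)"
    have "feasible_occupation M ?y"
      unfolding feasible_occupation_def
    proof (intro conjI ballI allI)
      fix t s assume t: "t \<in> {2..horizon M}"
      have "(\<Sum>a\<in>UNIV. ?y t s a) = (\<Sum>a\<in>UNIV. x t s a) + e * (\<Sum>a\<in>UNIV. w (t, s, a))"
        by (simp add: sum.distrib sum_distrib_left)
      also have "\<dots> = (\<Sum>a\<in>UNIV. \<Sum>s'\<in>UNIV. x (t - 1) s' a * pmf (kernel M (t - 1) s' a) s) +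
          e * (\<Sum>a\<in>UNIV. \<Sum>s'\<in>UNIV. w (t - 1, s', a) * pmf (kernel M (t - 1) s' a) s)"
        using flow0[OF t, of s] feas t by (simp add: flow_def feasible_occupation_def)
      also have "\<dots> = (\<Sum>a\<in>UNIV. \<Sum>s'\<in>UNIV. ?y (t - 1) s' a * pmf (kernel M (t - 1) s' a) s)"
        by (simp add: sum.distrib sum_distrib_left algebra_simps)
      finally show "(\<Sum>a\<in>UNIV. ?y t s a) =
        (\<Sum>a\<in>UNIV. \<Sum>s'\<in>UNIV. ?y (t - 1) s' a * pmf (kernel M (t - 1) s' a) s)" .
    next
      fix t assume t: "t \<in> epochs M"
      then show "(\<Sum>s\<in>UNIV. ?y t s True) = ratio M t"
        using pulls0[OF t] feas
        by (simp add: pulls_def feasible_occupation_def sum.distrib flip: sum_distrib_left)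
    next
      show "(\<Sum>a\<in>UNIV. ?y 1 (init M) a) = 1"
        using init0 feas
        by (simp add: start_def feasible_occupation_def sum.distrib flip: sum_distrib_left)
      show "(\<Sum>s\<in>UNIV. \<Sum>a\<in>UNIV. ?y 1 s a) = 1"
        using init0 feas
        by (simp add: total_def feasible_occupation_def sum.distrib flip: sum_distrib_left)
    qed (use e in auto)
    then have "occupation_reward M ?y \<le> occupation_reward M x"
      using opt by (simp add: optimal_occupation_def)
    moreover have "occupation_reward M ?y = occupation_reward M x + e * f w"
      unfolding occupation_reward_def f_def
      by (simp add: algebra_simps sum.distrib sum_distrib_left)
    ultimately show ?thesis using e by (simp add: mult_le_0_iff)
  qed
  have "f w = 0" if w: "\<forall>g\<in>G. g w = 0" for w
  proof -
    have neg: "g (\<lambda>i. - w i) = - g w" if "linear_functional g" for g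
    proof -
      \<comment> \<open>adding \<open>-2\<close> times \<open>w\<close> to \<open>w\<close> avoids a separate treatment of the zero vector\<close>
      have "g (\<lambda>i. w i + (-2) * w i) = g w + (-2) * g w"
        using that unfolding linear_functional_def by blast
      then show ?thesis by simp
    qed
    have "\<forall>g\<in>G. g (\<lambda>i. - w i) = 0" using w linG neg by (metis minus_zero)
    then have "f (\<lambda>i. - w i) \<le> 0" by (rule one_sided)
    then show ?thesis using one_sided[OF w] neg[OF lin(1)] by simp
  qed
  then obtain K where K: "\<And>v B. \<forall>g\<in>G. \<bar>g v\<bar> \<le> B \<Longrightarrow> \<bar>f v\<bar> \<le> K * B"
    using bounded_by_functionals_with_smaller_kernel[OF \<open>finite G\<close> lin(1) linG] by blast
  have "occupation_reward M x - occupation_reward M y \<le> K * B"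
    if y: "feasible_occupation M y" and B: "0 \<le> B"
      "\<forall>t\<in>epochs M. \<forall>s a. x t s a = 0 \<longrightarrow> y t s a \<le> B" for y B
  proof -
    let ?w = "\<lambda>(t, s, a). y t s a - x t s a"
    have "flow t s ?w = 0" if "t \<in> {2..horizon M}" for t s
      using y feas that by (simp add: flow_def feasible_occupation_def sum_subtractf algebra_simps)
    moreover have "pulls t ?w = 0" if "t \<in> epochs M" for t
      using y feas that by (simp add: pulls_def feasible_occupation_def sum_subtractf)
    moreover have "start ?w = 0" "total ?w = 0"
      using y feas by (simp_all add: start_def total_def feasible_occupation_def sum_subtractf)
    moreover have "\<bar>?w i\<bar> \<le> B" if "i \<in> Z" for i
      using that y B by (auto simp: Z_def feasible_occupation_def)
    ultimately have "\<forall>g\<in>G. \<bar>g ?w\<bar> \<le> B" using B(1) unfolding G_def by auto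
    then have "\<bar>f ?w\<bar> \<le> K * B" by (rule K)
    moreover have "f ?w = occupation_reward M y - occupation_reward M x"
      unfolding f_def occupation_reward_def by (simp add: sum_subtractf algebra_simps)
    ultimately show ?thesis by linarith
  qed
  then show ?thesis by blast
qed

section \<open>Moments under independent transitions\<close>

lemma integrable_pmf_bounded:
  fixes h :: "'a \<Rightarrow> real"
  assumes "\<And>x. \<bar>h x\<bar> \<le> B"
  shows "integrable (measure_pmf p) h"
  using assms by (intro measure_pmf.integrable_const_bound[where B = B]) auto

text \<open>
  Arm-level policies may randomize over infinitely many action vectors, because the entries beyond the
  \<open>N\<close> arms are unconstrained.  Expectations therefore range over infinite supports, and boundedness of
  the integrand takes the place of finiteness.
\<close>
lemma expectation_bind_pmf:
  fixes h :: "'b \<Rightarrow> real"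
  assumes "\<And>y. \<bar>h y\<bar> \<le> B"
  shows "measure_pmf.expectation (bind_pmf p f) h =
    measure_pmf.expectation p (\<lambda>x. measure_pmf.expectation (f x) h)"
  unfolding measure_pmf_bind
  by (rule integral_bind[where K = "count_space UNIV" and B = B and B' = 1])
     (use assms measurable_measure_pmf[of f] in
       \<open>auto simp: measure_pmf.finite_measure_axioms measure_pmf.emeasure_space_1\<close>)

lemma expectation_pmf_cong:
  fixes f g :: "'a \<Rightarrow> real"
  assumes "\<And>x. x \<in> set_pmf p \<Longrightarrow> f x = g x"
  shows "measure_pmf.expectation p f = measure_pmf.expectation p g"
  using assms by (intro integral_cong_AE) (auto simp: AE_measure_pmf_iff)

text \<open>
  The cross terms of the square vanish by independence, so the variances of the summands add up.
\<close>
lemma independent_centred_sum_moments: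
  fixes g :: "'i \<Rightarrow> 'b \<Rightarrow> real"
  assumes "finite A" and "\<And>i y. i \<in> A \<Longrightarrow> \<bar>g i y\<bar> \<le> 1"
    and "\<And>i. i \<in> A \<Longrightarrow> measure_pmf.expectation (p i) (g i) = 0"
  shows "measure_pmf.expectation (Pi_pmf A d p) (\<lambda>f. \<Sum>i\<in>A. g i (f i)) = 0 \<and>
    measure_pmf.expectation (Pi_pmf A d p) (\<lambda>f. (\<Sum>i\<in>A. g i (f i))\<^sup>2) \<le> real (card A)"
  using assms
proof (induction A rule: finite_induct)
  case empty
  then show ?case by simp
next
  case (insert k A)
  let ?S = "\<lambda>f. \<Sum>i\<in>A. g i (f i)"
  let ?Q = "Pi_pmf A d p"
  have S_upd: "(\<Sum>i\<in>insert k A. g i ((f(k := y)) i)) = g k y + ?S f" for f y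
    using insert.hyps by (simp add: sum.insert_if) (auto intro: sum.cong)
  have bounded: "\<bar>\<Sum>i\<in>J. g i (f i)\<bar> \<le> real (card J)" if "J \<subseteq> insert k A" for f J
    using sum_norm_bound[of J "\<lambda>i. g i (f i)" 1] insert.prems(1) that
    by (simp add: subset_iff)
  have bounded_sq: "\<bar>(\<Sum>i\<in>J. g i (f i))\<^sup>2\<bar> \<le> (real (card J))\<^sup>2" if "J \<subseteq> insert k A" for f J
    using bounded[OF that, of f] by (simp add: power2_le_iff_abs_le)
  have int: "integrable ?Q ?S" "integrable ?Q (\<lambda>f. (?S f)\<^sup>2)"
    by (rule integrable_pmf_bounded, rule bounded[OF subset_insertI],
        rule integrable_pmf_bounded, rule bounded_sq[OF subset_insertI])
  have gk: "\<bar>g k y\<bar> \<le> 1" for y using insert.prems(1) by simp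
  have gk_sq: "\<bar>(g k y)\<^sup>2\<bar> \<le> 1" for y using gk[of y] by (simp add: abs_square_le_1)
  have int_k: "integrable (p k) (g k)" "integrable (p k) (\<lambda>y. (g k y)\<^sup>2)"
    by (rule integrable_pmf_bounded, rule gk, rule integrable_pmf_bounded, rule gk_sq)
  have IH: "measure_pmf.expectation ?Q ?S = 0" "measure_pmf.expectation ?Q (\<lambda>f. (?S f)\<^sup>2) \<le> real (card A)"
    using insert.IH insert.prems by auto
  have expand: "measure_pmf.expectation (Pi_pmf (insert k A) d p) h =
      measure_pmf.expectation (p k) (\<lambda>y. measure_pmf.expectation ?Q (\<lambda>f. h (f(k := y))))"
    if "\<And>f. \<bar>h f\<bar> \<le> B" for h :: "('i \<Rightarrow> 'b) \<Rightarrow> real" and B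
    using insert.hyps that
    by (simp add: Pi_pmf_insert' expectation_bind_pmf[where B = B])
  have "measure_pmf.expectation (Pi_pmf (insert k A) d p) (\<lambda>f. \<Sum>i\<in>insert k A. g i (f i)) =
      measure_pmf.expectation (p k) (\<lambda>y. measure_pmf.expectation ?Q (\<lambda>f. g k y + ?S f))"
    by (subst expand[OF bounded[OF order_refl]]) (simp only: S_upd)
  also have "\<dots> = 0" using int IH insert.prems(2)[of k] by simp
  finally have mean: "measure_pmf.expectation (Pi_pmf (insert k A) d p)
      (\<lambda>f. \<Sum>i\<in>insert k A. g i (f i)) = 0" .
  have inner: "measure_pmf.expectation ?Q (\<lambda>f. (g k y + ?S f)\<^sup>2) =
      (g k y)\<^sup>2 + measure_pmf.expectation ?Q (\<lambda>f. (?S f)\<^sup>2)" for y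
    using int IH(1) by (simp add: power2_sum)
  have "measure_pmf.expectation (Pi_pmf (insert k A) d p) (\<lambda>f. (\<Sum>i\<in>insert k A. g i (f i))\<^sup>2) =
      measure_pmf.expectation (p k) (\<lambda>y. measure_pmf.expectation ?Q (\<lambda>f. (g k y + ?S f)\<^sup>2))"
    by (subst expand[OF bounded_sq[OF order_refl]]) (simp only: S_upd)
  also have "\<dots> = measure_pmf.expectation (p k) (\<lambda>y. (g k y)\<^sup>2) +
      measure_pmf.expectation ?Q (\<lambda>f. (?S f)\<^sup>2)"
    unfolding inner using int_k by simp
  also have "\<dots> \<le> 1 + real (card A)"
  proof (rule add_mono)
    show "measure_pmf.expectation (p k) (\<lambda>y. (g k y)\<^sup>2) \<le> 1"
      using gk_sq int_k by (intro measure_pmf.integral_le_const) auto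
  qed (rule IH)
  finally show ?case using mean insert.hyps by simp
qed

lemma sum_over_arms:
  fixes F :: "'s::finite \<Rightarrow> bool \<Rightarrow> real"
  shows "(\<Sum>i<N. F (\<sigma> i) (a i)) = (\<Sum>b\<in>UNIV. \<Sum>s\<in>UNIV. real (action_count N \<sigma> a s b) * F s b)"
proof -
  have "real (action_count N \<sigma> a s b) = (\<Sum>i<N. of_bool (\<sigma> i = s \<and> a i = b))" for s b
  proof -
    have "{i. i < N \<and> \<sigma> i = s \<and> a i = b} = {..<N} \<inter> {i. \<sigma> i = s \<and> a i = b}" by auto
    then show ?thesis by (simp add: action_count_def)
  qed
  then have "(\<Sum>b\<in>UNIV. \<Sum>s\<in>UNIV. real (action_count N \<sigma> a s b) * F s b) =
      (\<Sum>b\<in>UNIV. \<Sum>s\<in>UNIV. \<Sum>i<N. of_bool (\<sigma> i = s \<and> a i = b) * F s b)"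
    by (simp add: sum_distrib_right)
  also have "\<dots> = (\<Sum>b\<in>UNIV. \<Sum>i<N. \<Sum>s\<in>UNIV. of_bool (\<sigma> i = s \<and> a i = b) * F s b)"
    by (intro sum.cong refl sum.swap)
  also have "\<dots> = (\<Sum>i<N. \<Sum>b\<in>UNIV. \<Sum>s\<in>UNIV. of_bool (\<sigma> i = s \<and> a i = b) * F s b)"
    by (rule sum.swap)
  also have "\<dots> = (\<Sum>i<N. F (\<sigma> i) (a i))"
  proof (intro sum.cong refl)
    fix i
    have "(\<Sum>s\<in>UNIV. of_bool (\<sigma> i = s \<and> a i = b) * F s b) = of_bool (a i = b) * F (\<sigma> i) b" for b
    proof -
      have "(\<Sum>s\<in>UNIV. of_bool (\<sigma> i = s \<and> a i = b) * F s b) =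
          (\<Sum>s\<in>UNIV. if \<sigma> i = s then of_bool (a i = b) * F s b else 0)"
        by (intro sum.cong) auto
      then show ?thesis by simp
    qed
    then show "(\<Sum>b\<in>UNIV. \<Sum>s\<in>UNIV. of_bool (\<sigma> i = s \<and> a i = b) * F s b) = F (\<sigma> i) (a i)"
      by (cases "a i") (simp_all add: UNIV_bool)
  qed
  finally show ?thesis ..
qed

lemma action_count_le: "action_count N \<sigma> a s b \<le> N"
  using card_mono[of "{..<N}" "{i. i < N \<and> \<sigma> i = s \<and> a i = b}"] by (auto simp: action_count_def)

lemma state_count_le: "state_count N \<sigma> s \<le> N"
  using card_mono[of "{..<N}" "{i. i < N \<and> \<sigma> i = s}"] by (auto simp: state_count_def)

lemma state_count_eq_sum: "real (state_count N \<sigma> s) = (\<Sum>i<N. of_bool (\<sigma> i = s))"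
proof -
  have "{i. i < N \<and> \<sigma> i = s} = {..<N} \<inter> {i. \<sigma> i = s}" by auto
  then show ?thesis by (simp add: state_count_def)
qed

lemma sum_action_count: "(\<Sum>b\<in>UNIV. action_count N \<sigma> a s b) = state_count N \<sigma> s"
proof -
  have "state_count N \<sigma> s = card ({i. i < N \<and> \<sigma> i = s \<and> a i = False} \<union> {i. i < N \<and> \<sigma> i = s \<and> a i = True})"
    unfolding state_count_def by (rule arg_cong[where f = card]) auto
  also have "\<dots> = card {i. i < N \<and> \<sigma> i = s \<and> a i = False} + card {i. i < N \<and> \<sigma> i = s \<and> a i = True}"
    by (rule card_Un_disjoint) auto
  finally show ?thesis by (simp add: action_count_def UNIV_bool)
qed

definition next_state_mean ::
  "'s::finite bandit \<Rightarrow> nat \<Rightarrow> ('s \<Rightarrow> bool \<Rightarrow> real) \<Rightarrow> 's \<Rightarrow> real" where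
  "next_state_mean M t X s = (\<Sum>b\<in>UNIV. \<Sum>s'\<in>UNIV. X s' b * pmf (kernel M t s' b) s)"

definition next_states ::
  "'s bandit \<Rightarrow> nat \<Rightarrow> nat \<Rightarrow> (nat \<Rightarrow> 's) \<times> (nat \<Rightarrow> bool) \<Rightarrow> (nat \<Rightarrow> 's) pmf" where
  "next_states M N t = (\<lambda>(\<sigma>, a). Pi_pmf {..<N} (init M) (\<lambda>i. kernel M t (\<sigma> i) (a i)))"

lemma next_state_count_moments:
  fixes M :: "'s::finite bandit" and N t :: nat
  defines "m \<equiv> \<lambda>\<sigma> a. next_state_mean M t (\<lambda>s b. real (action_count N \<sigma> a s b))"
  shows "measure_pmf.expectation (next_states M N t (\<sigma>, a)) (\<lambda>\<sigma>'. real (state_count N \<sigma>' s)) = m \<sigma> a s"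
    and "measure_pmf.expectation (next_states M N t (\<sigma>, a))
      (\<lambda>\<sigma>'. (real (state_count N \<sigma>' s) - m \<sigma> a s)\<^sup>2) \<le> real N"
proof -
  let ?q = "\<lambda>i. kernel M t (\<sigma> i) (a i)"
  define g :: "nat \<Rightarrow> 's \<Rightarrow> real" where "g i y = of_bool (y = s) - pmf (?q i) s" for i y
  have m: "m \<sigma> a s = (\<Sum>i<N. pmf (?q i) s)"
    unfolding m_def next_state_mean_def
    using sum_over_arms[of "\<lambda>s' b. pmf (kernel M t s' b) s" \<sigma> a N] by simp
  have centred: "real (state_count N \<sigma>' s) - m \<sigma> a s = (\<Sum>i<N. g i (\<sigma>' i))" for \<sigma>'
    by (simp add: m g_def state_count_eq_sum sum_subtractf)
  have "\<bar>g i y\<bar> \<le> 1" for i y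
    using pmf_nonneg[of "?q i" s] pmf_le_1[of "?q i" s] by (simp add: g_def)
  moreover have "measure_pmf.expectation (?q i) (g i) = 0" for i
  proof -
    have "(\<lambda>y. of_bool (y = s)) = (indicator {s} :: 's \<Rightarrow> real)"
      by (auto simp: indicator_def)
    then have "measure_pmf.expectation (?q i) (\<lambda>y. of_bool (y = s)) = pmf (?q i) s"
      by (simp add: measure_pmf_single)
    then show ?thesis unfolding g_def by (simp add: integrable_measure_pmf_finite)
  qed
  ultimately have mom: "measure_pmf.expectation (next_states M N t (\<sigma>, a)) (\<lambda>\<sigma>'. \<Sum>i<N. g i (\<sigma>' i)) = 0"
    "measure_pmf.expectation (next_states M N t (\<sigma>, a)) (\<lambda>\<sigma>'. (\<Sum>i<N. g i (\<sigma>' i))\<^sup>2) \<le> real N"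
    using independent_centred_sum_moments[of "{..<N}" g ?q "init M"] by (auto simp: next_states_def)
  show "measure_pmf.expectation (next_states M N t (\<sigma>, a))
      (\<lambda>\<sigma>'. (real (state_count N \<sigma>' s) - m \<sigma> a s)\<^sup>2) \<le> real N"
    unfolding centred by (rule mom)
  have "integrable (measure_pmf (next_states M N t (\<sigma>, a))) (\<lambda>\<sigma>'. real (state_count N \<sigma>' s))"
    by (rule integrable_pmf_bounded[where B = "real N"]) (simp add: state_count_le)
  then show "measure_pmf.expectation (next_states M N t (\<sigma>, a)) (\<lambda>\<sigma>'. real (state_count N \<sigma>' s)) = m \<sigma> a s"
    using mom(1) unfolding centred[symmetric] by simp
qed

section \<open>Mean occupation measures of arm-level policies\<close>

text \<open>
  The times here are \<open>t \<ge> 1\<close>: the state vector of time \<open>t\<close> is already determined after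
  \<open>t - 1\<close> transitions.
\<close>
definition state_law :: "'s bandit \<Rightarrow> nat \<Rightarrow> 's arm_policy \<Rightarrow> nat \<Rightarrow> (nat \<Rightarrow> 's) pmf" where
  "state_law M N \<phi> t = map_pmf (\<lambda>(\<sigma>, \<rho>). \<sigma> t) (trajectory M N \<phi> (t - 1))"

definition decision_law ::
  "'s bandit \<Rightarrow> nat \<Rightarrow> 's arm_policy \<Rightarrow> nat \<Rightarrow> ((nat \<Rightarrow> 's) \<times> (nat \<Rightarrow> bool)) pmf" where
  "decision_law M N \<phi> t = map_pmf (\<lambda>(\<sigma>, \<rho>). (\<sigma> t, \<rho> t)) (trajectory M N \<phi> t)"

lemma state_law_1: "state_law M N \<phi> (Suc 0) = return_pmf (\<lambda>_. init M)"
  by (simp add: state_law_def)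

lemma decision_law_Suc:
  "decision_law M N \<phi> (Suc k) =
     bind_pmf (state_law M N \<phi> (Suc k)) (\<lambda>\<sigma>. map_pmf (Pair \<sigma>) (\<phi> (Suc k) \<sigma>))"
  by (simp add: decision_law_def state_law_def map_bind_pmf bind_map_pmf case_prod_unfold
      map_pmf_def bind_assoc_pmf bind_return_pmf)

lemma state_law_Suc:
  "state_law M N \<phi> (Suc (Suc k)) = bind_pmf (decision_law M N \<phi> (Suc k)) (next_states M N (Suc k))"
  by (simp add: decision_law_def state_law_def next_states_def map_bind_pmf bind_map_pmf case_prod_unfold
      map_pmf_def bind_assoc_pmf bind_return_pmf bind_return_pmf')

lemma decision_law_marginal:
  assumes "t \<le> n"
  shows "map_pmf (\<lambda>(\<sigma>, \<rho>). (\<sigma> t, \<rho> t)) (trajectory M N \<phi> n) = decision_law M N \<phi> t"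
  using assms
proof (induction n rule: dec_induct)
  case base
  then show ?case by (simp add: decision_law_def)
next
  case (step n)
  then have "t \<noteq> Suc n" "t \<noteq> Suc (Suc n)" by auto
  then have "map_pmf (\<lambda>(\<sigma>, \<rho>). (\<sigma> t, \<rho> t)) (trajectory M N \<phi> (Suc n)) =
      map_pmf (\<lambda>(\<sigma>, \<rho>). (\<sigma> t, \<rho> t)) (trajectory M N \<phi> n)"
    by (simp add: map_bind_pmf case_prod_unfold map_pmf_def bind_assoc_pmf bind_return_pmf)
  then show ?case using step.IH by simp
qed

lemma decision_law_fst:
  "map_pmf fst (decision_law M N \<phi> (Suc k)) = state_law M N \<phi> (Suc k)"
  by (simp add: decision_law_Suc map_bind_pmf pmf.map_comp o_def bind_return_pmf')

lemma set_decision_law: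
  "(\<sigma>, a) \<in> set_pmf (decision_law M N \<phi> (Suc k)) \<Longrightarrow> a \<in> set_pmf (\<phi> (Suc k) \<sigma>)"
  by (auto simp: decision_law_Suc)

definition mean_occupation :: "'s bandit \<Rightarrow> nat \<Rightarrow> 's arm_policy \<Rightarrow> 's occupation" where
  "mean_occupation M N \<phi> t s b =
     measure_pmf.expectation (decision_law M N \<phi> t) (\<lambda>(\<sigma>, a). real (action_count N \<sigma> a s b)) / real N"

lemma integrable_action_count:
  "integrable (measure_pmf p) (\<lambda>(\<sigma>, a). real (action_count N \<sigma> a s b))"
  by (rule integrable_pmf_bounded[where B = "real N"]) (auto simp: action_count_le)

lemma mean_occupation_linear:
  fixes M :: "'s::finite bandit"
  assumes "0 < N"
  shows "measure_pmf.expectation (decision_law M N \<phi> t)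
      (\<lambda>(\<sigma>, a). \<Sum>b\<in>UNIV. \<Sum>s\<in>UNIV. real (action_count N \<sigma> a s b) * F s b) =
    real N * (\<Sum>b\<in>UNIV. \<Sum>s\<in>UNIV. mean_occupation M N \<phi> t s b * F s b)"
proof -
  have int: "integrable (measure_pmf p) (\<lambda>x. real (action_count N (fst x) (snd x) s b) * F s b)"
    for p :: "((nat \<Rightarrow> 's) \<times> (nat \<Rightarrow> bool)) pmf" and s b
    using integrable_action_count[of p N s b] by (simp add: case_prod_unfold)
  show ?thesis
    using assms int
    by (simp add: case_prod_unfold mean_occupation_def integral_sum sum_distrib_left mult.assoc)
qed

lemma arm_value_eq_occupation_reward:
  fixes M :: "'s::finite bandit"
  assumes "0 < N"
  shows "arm_value M N \<phi> = real N * occupation_reward M (mean_occupation M N \<phi>)"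
proof -
  let ?traj = "trajectory M N \<phi> (horizon M)"
  let ?R = "\<lambda>t (\<sigma>, a). \<Sum>b\<in>UNIV. \<Sum>s\<in>UNIV. real (action_count N \<sigma> a s b) * reward M t s b"
  have int: "integrable (measure_pmf p) (?R t)" for p t
    using integrable_action_count[where p = p and N = N]
    by (auto simp: case_prod_unfold intro!: Bochner_Integration.integrable_sum integrable_mult_left)
  have "arm_value M N \<phi> = measure_pmf.expectation ?traj
      (\<lambda>x. \<Sum>t\<in>epochs M. ?R t ((\<lambda>(\<sigma>, \<rho>). (\<sigma> t, \<rho> t)) x))"
    unfolding arm_value_def sum_over_arms by (simp add: case_prod_unfold)
  also have "\<dots> = (\<Sum>t\<in>epochs M. measure_pmf.expectation ?traj
      (\<lambda>x. ?R t ((\<lambda>(\<sigma>, \<rho>). (\<sigma> t, \<rho> t)) x)))"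
    by (intro Bochner_Integration.integral_sum) (subst integrable_map_pmf_eq[symmetric], rule int)
  also have "\<dots> = (\<Sum>t\<in>epochs M. measure_pmf.expectation (decision_law M N \<phi> t) (?R t))"
  proof (intro sum.cong refl)
    fix t assume "t \<in> epochs M"
    then have "t \<le> horizon M" by (simp add: epochs_def)
    then show "measure_pmf.expectation ?traj (\<lambda>x. ?R t ((\<lambda>(\<sigma>, \<rho>). (\<sigma> t, \<rho> t)) x)) =
        measure_pmf.expectation (decision_law M N \<phi> t) (?R t)"
      by (simp only: decision_law_marginal[symmetric] integral_map_pmf)
  qed
  also have "\<dots> = real N * occupation_reward M (mean_occupation M N \<phi>)"
    unfolding mean_occupation_linear[OF assms] occupation_reward_def sum_distrib_left
    by (intro sum.cong refl, subst sum.swap) (simp add: mult_ac)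
  finally show ?thesis .
qed

lemma relaxed_policy_iff:
  fixes M :: "'s::finite bandit"
  assumes "0 < N"
  shows "relaxed_policy M N \<phi> \<longleftrightarrow>
    (\<forall>t\<in>epochs M. (\<Sum>s\<in>UNIV. mean_occupation M N \<phi> t s True) = ratio M t)"
proof -
  have "measure_pmf.expectation (trajectory M N \<phi> (horizon M)) (\<lambda>(\<sigma>, \<rho>). real (card {i. i < N \<and> \<rho> t i})) =
      real N * (\<Sum>s\<in>UNIV. mean_occupation M N \<phi> t s True)" if "t \<in> epochs M" for t
  proof -
    have "card {i. i < N \<and> a i} = (\<Sum>i<N. of_bool (a i))" for a
    proof -
      have "{i. i < N \<and> a i} = {..<N} \<inter> {i. a i}" by auto
      then show ?thesis by simp
    qed
    then have count: "real (card {i. i < N \<and> a i}) =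
        (\<Sum>b\<in>UNIV. \<Sum>s\<in>UNIV. real (action_count N \<sigma> a s b) * of_bool b)" for a and \<sigma> :: "nat \<Rightarrow> 's"
      using sum_over_arms[of "\<lambda>_ b. of_bool b" \<sigma> a N] by simp
    have "measure_pmf.expectation (trajectory M N \<phi> (horizon M)) (\<lambda>(\<sigma>, \<rho>). real (card {i. i < N \<and> \<rho> t i})) =
        measure_pmf.expectation (decision_law M N \<phi> t) (\<lambda>(\<sigma>, a). real (card {i. i < N \<and> a i}))"
      using that by (subst decision_law_marginal[where n = "horizon M", symmetric])
        (simp_all add: epochs_def case_prod_unfold)
    also have "\<dots> = measure_pmf.expectation (decision_law M N \<phi> t)
        (\<lambda>(\<sigma>, a). \<Sum>b\<in>UNIV. \<Sum>s\<in>UNIV. real (action_count N \<sigma> a s b) * of_bool b)"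
      by (intro Bochner_Integration.integral_cong refl) (auto simp only: count split: prod.splits)
    also have "\<dots> = real N * (\<Sum>s\<in>UNIV. mean_occupation M N \<phi> t s True)"
      unfolding mean_occupation_linear[OF assms] by (simp add: UNIV_bool)
    finally show ?thesis .
  qed
  then show ?thesis using assms by (simp add: relaxed_policy_def mult.commute)
qed

lemma mean_occupation_states:
  fixes M :: "'s::finite bandit"
  assumes "0 < N"
  shows "(\<Sum>b\<in>UNIV. mean_occupation M N \<phi> (Suc k) s b) =
    measure_pmf.expectation (state_law M N \<phi> (Suc k)) (\<lambda>\<sigma>. real (state_count N \<sigma> s)) / real N"
proof -
  have "real N * (\<Sum>b\<in>UNIV. mean_occupation M N \<phi> (Suc k) s b) =
      real N * (\<Sum>b\<in>UNIV. \<Sum>s'\<in>UNIV. mean_occupation M N \<phi> (Suc k) s' b * of_bool (s' = s))"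
    by (simp add: of_bool_def if_distrib cong: if_cong)
  also have "\<dots> = measure_pmf.expectation (decision_law M N \<phi> (Suc k))
      (\<lambda>(\<sigma>, a). \<Sum>b\<in>UNIV. \<Sum>s'\<in>UNIV. real (action_count N \<sigma> a s' b) * of_bool (s' = s))"
    by (rule mean_occupation_linear[OF assms, symmetric])
  also have "\<dots> = measure_pmf.expectation (decision_law M N \<phi> (Suc k)) (\<lambda>x. real (state_count N (fst x) s))"
    by (simp add: sum_action_count case_prod_unfold of_bool_def if_distrib cong: if_cong flip: of_nat_sum)
  also have "\<dots> = measure_pmf.expectation (state_law M N \<phi> (Suc k)) (\<lambda>\<sigma>. real (state_count N \<sigma> s))"
    by (simp flip: decision_law_fst)
  finally show ?thesis using assms by (simp add: field_simps)
qed

text \<open>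
  Taking expectations of the transition law gives the flow constraint; no concentration
  is involved.
\<close>
lemma mean_occupation_feasible:
  fixes M :: "'s::finite bandit"
  assumes N: "0 < N" and T: "1 \<le> horizon M" and relaxed: "relaxed_policy M N \<phi>"
  shows "feasible_occupation M (mean_occupation M N \<phi>)"
proof -
  let ?y = "mean_occupation M N \<phi>"
  have first: "(\<Sum>b\<in>UNIV. ?y 1 s b) = of_bool (init M = s)" for s
    using N mean_occupation_states[OF N, of M \<phi> 0 s]
    by (simp add: state_law_1 state_count_def)
  have flow: "(\<Sum>b\<in>UNIV. ?y (Suc (Suc k)) s b) =
      (\<Sum>b\<in>UNIV. \<Sum>s'\<in>UNIV. ?y (Suc k) s' b * pmf (kernel M (Suc k) s' b) s)" for k s
  proof -
    have "measure_pmf.expectation (state_law M N \<phi> (Suc (Suc k))) (\<lambda>\<sigma>. real (state_count N \<sigma> s)) =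
        measure_pmf.expectation (decision_law M N \<phi> (Suc k))
          (\<lambda>(\<sigma>, a). \<Sum>b\<in>UNIV. \<Sum>s'\<in>UNIV. real (action_count N \<sigma> a s' b) * pmf (kernel M (Suc k) s' b) s)"
      unfolding state_law_Suc
      by (subst expectation_bind_pmf[where B = "real N"])
        (auto simp: state_count_le next_state_count_moments(1) next_state_mean_def
          intro!: Bochner_Integration.integral_cong)
    then show ?thesis
      unfolding mean_occupation_linear[OF N] using N by (simp add: mean_occupation_states)
  qed
  have "0 \<le> ?y t s b" for t s b
    unfolding mean_occupation_def by (auto intro!: divide_nonneg_nonneg Bochner_Integration.integral_nonneg)
  moreover have "(\<Sum>b\<in>UNIV. ?y t s b) =
      (\<Sum>b\<in>UNIV. \<Sum>s'\<in>UNIV. ?y (t - 1) s' b * pmf (kernel M (t - 1) s' b) s)"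
    if "t \<in> {2..horizon M}" for t s
  proof -
    have "t = Suc (Suc (t - 2))" using that by auto
    then obtain k where "t = Suc (Suc k)" by blast
    then show ?thesis using flow[of k s] by simp
  qed
  moreover have "(\<Sum>s\<in>UNIV. of_bool (init M = s)) = (1 :: real)"
    by (simp add: of_bool_def)
  ultimately show ?thesis
    using relaxed N first by (simp add: feasible_occupation_def relaxed_policy_iff)
qed

section \<open>Response of the fluid-priority policy to deviations from the fluid\<close>

lemma priority_pass_local:
  assumes "priority_pass L C cap (B, X) = (B', X')"
  shows "(\<forall>s. s \<notin> C \<longrightarrow> X' s = X s) \<and> (\<forall>s. X' s \<le> max (X s) (cap s))"
  using assms
proof (induction L arbitrary: B X)
  case Nil
  then show ?case by (simp add: priority_pass_def)
next
  case (Cons u L)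
  show ?case
  proof (cases "u \<in> C")
    case False
    then show ?thesis using Cons by (auto simp: priority_pass_def)
  next
    case True
    define m where "m = min B (cap u - X u)"
    define Y where "Y = X(u := X u + m)"
    have "priority_pass L C cap (B - m, Y) = (B', X')"
      using Cons.prems(1) True by (simp add: priority_pass_def m_def Y_def Let_def)
    note ih = Cons.IH[OF this]
    have "s \<notin> C \<Longrightarrow> Y s = X s" for s using True by (auto simp: Y_def)
    moreover have "max (Y s) (cap s) \<le> max (X s) (cap s)" for s
      by (auto simp: Y_def m_def min_def)
    ultimately show ?thesis using ih by (metis le_trans)
  qed
qed

lemma priority_pass_exhausted:
  fixes X :: "'s::finite \<Rightarrow> nat"
  assumes "priority_pass L C cap (0, X) = (B', X')"
  shows "B' = 0 \<and> X' = X"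
proof -
  have "B' + sum X' UNIV = sum X UNIV \<and> (\<forall>s. X s \<le> X' s)"
    using priority_pass_induct[OF assms, of "\<lambda>s. max (X s) (cap s)"] by simp
  moreover from this have "X' s = X s" for s
  proof -
    have "sum X UNIV \<le> sum X' UNIV" using calculation by (auto intro: sum_mono)
    then have "sum X' UNIV = sum X UNIV" using calculation by simp
    then show ?thesis using calculation sum_mono_inv[of X UNIV X' s] by auto
  qed
  ultimately show ?thesis by auto
qed

text \<open>
  The cases say how long the budget lasts: it is spent by the end of the first, second or third pass,
  or some of it is left for the fourth.  Passes that leave budget over are carried out in full, and
  passes after the budget is spent do nothing.
\<close>
lemma fluid_priority_cases:
  fixes M :: "'s::finite bandit"
  assumes L: "set (L t) = UNIV"
    and X: "X = fluid_priority_pulls M x L N t Z"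
  obtains
    (active) "\<And>s. s \<notin> fluid_active x t \<Longrightarrow> X s = 0"
  | (targets) "\<And>s. s \<in> fluid_active x t \<Longrightarrow> X s = Z s"
      "\<And>s. s \<in> fluid_neutral x t \<Longrightarrow> X s \<le> nat \<lfloor>real N * x t s True\<rfloor>"
      "\<And>s. s \<in> fluid_inactive x t \<Longrightarrow> X s = 0"
  | (neutral) "\<And>s. s \<in> fluid_active x t \<Longrightarrow> X s = Z s"
      "\<And>s. s \<in> fluid_neutral x t \<Longrightarrow> min (Z s) (nat \<lfloor>real N * x t s True\<rfloor>) \<le> X s"
      "\<And>s. s \<in> fluid_inactive x t \<Longrightarrow> X s = 0"
  | (inactive) "\<And>s. s \<in> fluid_active x t \<union> fluid_neutral x t \<Longrightarrow> X s = Z s"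
proof -
  let ?c2 = "\<lambda>s::'s. min (Z s) (nat \<lfloor>real N * x t s True\<rfloor>)"
  obtain B1 X1 where 1: "priority_pass (L t) (fluid_active x t) Z (budget M N t, \<lambda>_. 0) = (B1, X1)"
    by fastforce
  obtain B2 X2 where 2: "priority_pass (L t) (fluid_neutral x t) ?c2 (B1, X1) = (B2, X2)"
    by fastforce
  obtain B3 X3 where 3: "priority_pass (L t) (fluid_neutral x t) Z (B2, X2) = (B3, X3)"
    by fastforce
  obtain B4 X4 where 4: "priority_pass (L t) (fluid_inactive x t) Z (B3, X3) = (B4, X4)"
    by fastforce
  have X4: "X = X4"
    by (simp add: X fluid_priority_pulls_def 1 2 3 4)
  note p1 = priority_pass_induct[OF 1, where Z = Z, simplified]
  have p2: "\<forall>s. X1 s \<le> X2 s" "\<forall>s. X2 s \<le> Z s"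
    "0 < B2 \<Longrightarrow> \<forall>s\<in>fluid_neutral x t \<inter> set (L t). ?c2 s \<le> X2 s"
    using priority_pass_induct[OF 2, where Z = Z] p1 by auto
  have p3: "\<forall>s. X2 s \<le> X3 s" "\<forall>s. X3 s \<le> Z s"
    "0 < B3 \<Longrightarrow> \<forall>s\<in>fluid_neutral x t \<inter> set (L t). Z s \<le> X3 s"
    using priority_pass_induct[OF 3, where Z = Z] p2 by auto
  have p4: "\<forall>s. X3 s \<le> X4 s" "\<forall>s. X4 s \<le> Z s"
    using priority_pass_induct[OF 4, where Z = Z] p3 by auto
  note loc = priority_pass_local[OF 1] priority_pass_local[OF 2] priority_pass_local[OF 3]
    priority_pass_local[OF 4]
  have disj: "s \<in> fluid_active x t \<Longrightarrow> s \<notin> fluid_neutral x t"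
    "s \<in> fluid_inactive x t \<Longrightarrow> s \<notin> fluid_neutral x t \<and> s \<notin> fluid_active x t" for s
    by (auto simp: fluid_active_def fluid_neutral_def fluid_inactive_def)
  have active_full: "X s = Z s" if "0 < B1" "s \<in> fluid_active x t" for s
    using p1 that L p2(1) p3(1) p4 unfolding X4 by (metis IntI UNIV_I le_antisym le_trans)
  have inactive_empty: "X3 s = 0" if "s \<in> fluid_inactive x t" for s
    using loc disj(2)[OF that] by simp
  consider "B1 = 0" | "0 < B1" "B2 = 0" | "0 < B2" "B3 = 0" | "0 < B3" by auto
  then show thesis
  proof cases
    case 1
    then have "X4 = X1" using 2 3 4 priority_pass_exhausted by metis
    then show ?thesis using loc(1) X4 by (intro active) auto
  next
    case 2
    then have X24: "X4 = X2" using 3 4 priority_pass_exhausted by metis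
    have "X s \<le> nat \<lfloor>real N * x t s True\<rfloor>" if "s \<in> fluid_neutral x t" for s
    proof -
      have "X1 s = 0" using loc(1) disj(1) that by blast
      then show ?thesis using loc(2) unfolding X4 X24 by (metis max_0L min.boundedE)
    qed
    moreover have "X s = 0" if "s \<in> fluid_inactive x t" for s
      using loc(1,2) disj(2)[OF that] unfolding X4 X24 by simp
    ultimately show ?thesis using active_full 2 by (intro targets) auto
  next
    case 3
    have "0 < B1" using 3 \<open>priority_pass (L t) (fluid_neutral x t) ?c2 (B1, X1) = (B2, X2)\<close>
      priority_pass_exhausted by (metis gr0I less_numeral_extra(3))
    moreover have "X4 = X3" using 3 4 priority_pass_exhausted by metis
    moreover have "?c2 s \<le> X s" if "s \<in> fluid_neutral x t" for s
      using that p2(3) 3 L p3(1) p4(1) unfolding X4 by (metis IntI UNIV_I le_trans)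
    ultimately show ?thesis using active_full inactive_empty X4 by (intro neutral) auto
  next
    case 4
    have "0 < B2" using 4 3 priority_pass_exhausted by (metis gr0I less_numeral_extra(3))
    then have "0 < B1" using 2 priority_pass_exhausted by (metis gr0I less_numeral_extra(3))
    moreover have "X s = Z s" if "s \<in> fluid_neutral x t" for s
      using that p3(3) 4 L p4 unfolding X4 by (metis IntI UNIV_I le_antisym le_trans)
    ultimately show ?thesis using active_full by (intro inactive) auto
  qed
qed

text \<open>
  If the sum is \<open>0\<close>, the positive and the negative parts have the same total, so a bound on either
  of them suffices.
\<close>
lemma sum_abs_le_positive_parts:
  fixes u v :: "'a \<Rightarrow> real"
  assumes "sum u S = 0" and "\<And>s. s \<in> S \<Longrightarrow> u s \<le> v s" and "\<And>s. s \<in> S \<Longrightarrow> 0 \<le> v s"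
  shows "(\<Sum>s\<in>S. \<bar>u s\<bar>) \<le> 2 * sum v S"
proof -
  have "\<bar>u s\<bar> \<le> 2 * v s - u s" if "s \<in> S" for s using assms(2,3)[OF that] by (auto simp: abs_if)
  then have "(\<Sum>s\<in>S. \<bar>u s\<bar>) \<le> (\<Sum>s\<in>S. 2 * v s - u s)" by (intro sum_mono)
  also have "\<dots> = 2 * sum v S" using assms(1) by (simp add: sum_subtractf sum_distrib_left)
  finally show ?thesis .
qed

definition fluid_state :: "'s::finite occupation \<Rightarrow> nat \<Rightarrow> 's \<Rightarrow> real" where
  "fluid_state x t s = (\<Sum>a\<in>UNIV. x t s a)"

definition fluid_deviation :: "'s::finite occupation \<Rightarrow> nat \<Rightarrow> nat \<Rightarrow> ('s \<Rightarrow> nat) \<Rightarrow> real" where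
  "fluid_deviation x N t Z = (\<Sum>s\<in>UNIV. \<bar>real (Z s) - real N * fluid_state x t s\<bar>)"

context
  fixes M :: "'s::finite bandit" and x :: "'s occupation"
    and L :: "nat \<Rightarrow> 's list" and N t :: nat and Z X :: "'s \<Rightarrow> nat"
  assumes feas: "feasible_occupation M x" and t: "t \<in> epochs M"
    and L: "set (L t) = UNIV"
    and X: "X = fluid_priority_pulls M x L N t Z"
    and XZ: "\<And>s. X s \<le> Z s"
    and total: "(\<Sum>s\<in>UNIV. real (X s)) = ratio M t * real N"
begin

lemma fluid_state_split: "fluid_state x t s = x t s True + x t s False"
  by (simp add: fluid_state_def UNIV_bool)

lemma occupation_nonneg: "0 \<le> x t s a"
  using feas t by (simp add: feasible_occupation_def)

lemma occupation_classes:
  "s \<in> fluid_active x t \<or> s \<in> fluid_neutral x t \<or> s \<in> fluid_inactive x t"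
  using occupation_nonneg[of s True] occupation_nonneg[of s False]
  by (auto simp: fluid_active_def fluid_neutral_def fluid_inactive_def)

lemma fluid_pulls: "(\<Sum>s\<in>UNIV. x t s True) = ratio M t"
  using feas t by (simp add: feasible_occupation_def)

text \<open>
  The pull counts and their fluid targets have the same total.  It is therefore enough to bound the
  excess over the targets, which can only come from extra arms in fluid-active states if the budget
  runs out in the first two passes; otherwise it is enough to bound the shortfall, which can only
  come from missing arms and from rounding down.
\<close>
lemma pulls_near_fluid:
  "(\<Sum>s\<in>UNIV. \<bar>real (X s) - real N * x t s True\<bar>) \<le> 2 * (fluid_deviation x N t Z + real CARD('s))"
proof -
  let ?dev = "\<lambda>s. \<bar>real (Z s) - real N * fluid_state x t s\<bar>"
  let ?u = "\<lambda>s. real (X s) - real N * x t s True"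
  have bound: "(\<Sum>s\<in>UNIV. ?dev s + 1) = fluid_deviation x N t Z + real CARD('s)"
    by (simp add: fluid_deviation_def sum.distrib)
  have sum0: "sum ?u UNIV = 0"
    using total fluid_pulls by (simp add: sum_subtractf flip: sum_distrib_left)
  have active_state: "fluid_state x t s = x t s True" if "s \<in> fluid_active x t" for s
    using that by (simp add: fluid_state_split fluid_active_def)
  have inactive_state: "x t s True = 0" if "s \<in> fluid_inactive x t" for s
    using that by (simp add: fluid_inactive_def)
  have Nx: "0 \<le> real N * x t s a" for s a by (simp add: occupation_nonneg)
  have state_ge: "real N * x t s True \<le> real N * fluid_state x t s" for s
    using Nx[of s False] by (simp add: fluid_state_split distrib_left)
  have XZ': "real (X s) \<le> real (Z s)" for s using XZ by simp
  have excess: "(\<Sum>s\<in>UNIV. \<bar>?u s\<bar>) \<le> 2 * (\<Sum>s\<in>UNIV. ?dev s + 1)"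
    if "\<And>s. ?u s \<le> ?dev s + 1"
    using that by (intro sum_abs_le_positive_parts sum0) auto
  have deficit: "(\<Sum>s\<in>UNIV. \<bar>?u s\<bar>) \<le> 2 * (\<Sum>s\<in>UNIV. ?dev s + 1)"
    if "\<And>s. - ?u s \<le> ?dev s + 1"
  proof -
    have "(\<Sum>s\<in>UNIV. \<bar>- ?u s\<bar>) \<le> 2 * (\<Sum>s\<in>UNIV. ?dev s + 1)"
      using that sum0 by (intro sum_abs_le_positive_parts) (auto simp: sum_negf simp del: minus_diff_eq)
    then show ?thesis by (simp only: abs_minus_cancel)
  qed
  have active_excess: "?u s \<le> ?dev s + 1" if "s \<in> fluid_active x t" for s
    using XZ'[of s] active_state[OF that] by (simp add: abs_if)
  from L X show ?thesis
  proof (cases rule: fluid_priority_cases)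
    case active
    have "?u s \<le> ?dev s + 1" for s
      using active active_excess Nx[of s True] by (cases "s \<in> fluid_active x t") auto
    then show ?thesis by (rule excess[unfolded bound])
  next
    case targets
    have "?u s \<le> ?dev s + 1" for s
      using occupation_classes[of s]
    proof (elim disjE)
      assume "s \<in> fluid_neutral x t"
      then have "real (X s) \<le> real N * x t s True"
        using targets(2)[of s] Nx[of s True] by linarith
      then show ?thesis by simp
    qed (use active_excess targets(3) Nx[of s True] in auto)
    then show ?thesis by (rule excess[unfolded bound])
  next
    case neutral
    have "- ?u s \<le> ?dev s + 1" for s
      using occupation_classes[of s]
    proof (elim disjE)
      assume "s \<in> fluid_active x t"
      then show ?thesis using neutral(1) active_state by simp
    next
      assume s: "s \<in> fluid_neutral x t"
      have "real N * x t s True - 1 \<le> real (nat \<lfloor>real N * x t s True\<rfloor>)" by linarith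
      then show ?thesis using neutral(2)[OF s] state_ge[of s] by (auto simp: abs_if min_def split: if_splits)
    next
      assume "s \<in> fluid_inactive x t"
      then show ?thesis using inactive_state by simp
    qed
    then show ?thesis by (rule deficit[unfolded bound])
  next
    case inactive
    have "- ?u s \<le> ?dev s + 1" for s
      using occupation_classes[of s]
    proof (elim disjE)
      assume "s \<in> fluid_inactive x t"
      then show ?thesis using inactive_state by simp
    qed (use inactive state_ge[of s] in \<open>auto simp: abs_if\<close>)
    then show ?thesis by (rule deficit[unfolded bound])
  qed
qed

text \<open>
  A fluid-active arm is idled only if the fluid-active states alone exhaust the budget, although their
  fluid demand leaves room for the pulls in fluid-neutral states; a fluid-inactive arm is pulled only
  if the fluid-active and fluid-neutral states together hold too few arms, although in the fluid they
  exceed the budget by the idle mass of the fluid-neutral states.  Either way the deviation is at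
  least \<open>\<delta> * N\<close>, so that its square compensates the trivial bound \<open>N\<close> on the number of misplaced arms.
\<close>
lemma misplaced_arms_bound:
  assumes d: "\<delta> \<le> (\<Sum>s\<in>fluid_neutral x t. x t s True)" "\<delta> \<le> (\<Sum>s\<in>fluid_neutral x t. x t s False)"
    and "0 \<le> \<delta>" and ZN: "(\<Sum>s\<in>UNIV. Z s) = N"
  shows "((\<Sum>s\<in>fluid_inactive x t. real (X s)) + (\<Sum>s\<in>fluid_active x t. real (Z s) - real (X s))) *
    (\<delta>\<^sup>2 * real N) \<le> (fluid_deviation x N t Z)\<^sup>2"
    (is "?D * _ \<le> ?d\<^sup>2")
proof (cases "?D = 0")
  case True
  then show ?thesis by simp
next
  case False
  have disj: "fluid_active x t \<inter> fluid_neutral x t = {}" "fluid_active x t \<inter> fluid_inactive x t = {}"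
    by (auto simp: fluid_active_def fluid_neutral_def fluid_inactive_def)
  have XZ': "real (X s) \<le> real (Z s)" for s using XZ by simp
  have "?D \<le> (\<Sum>s\<in>fluid_inactive x t. real (Z s)) + (\<Sum>s\<in>fluid_active x t. real (Z s))"
    by (intro add_mono sum_mono) (auto simp: XZ)
  also have "\<dots> = (\<Sum>s\<in>fluid_inactive x t \<union> fluid_active x t. real (Z s))"
    using disj by (subst sum.union_disjoint) auto
  also have "\<dots> \<le> (\<Sum>s\<in>UNIV. real (Z s))" by (intro sum_mono2) auto
  also have "\<dots> = real N" using ZN by (simp flip: of_nat_sum)
  finally have DN: "?D \<le> real N" .
  have dev_part: "\<bar>(\<Sum>s\<in>S. real (Z s)) - real N * (\<Sum>s\<in>S. fluid_state x t s)\<bar> \<le> ?d" for S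
  proof -
    have "\<bar>\<Sum>s\<in>S. real (Z s) - real N * fluid_state x t s\<bar>
        \<le> (\<Sum>s\<in>S. \<bar>real (Z s) - real N * fluid_state x t s\<bar>)" by (rule sum_abs)
    also have "\<dots> \<le> ?d" unfolding fluid_deviation_def by (intro sum_mono2) auto
    finally show ?thesis by (simp add: sum_subtractf sum_distrib_left)
  qed
  have x_split: "ratio M t = (\<Sum>s\<in>fluid_active x t. x t s True) + (\<Sum>s\<in>fluid_neutral x t. x t s True)"
  proof -
    have "ratio M t = (\<Sum>s\<in>fluid_active x t \<union> fluid_neutral x t. x t s True)"
      unfolding fluid_pulls[symmetric] using occupation_classes
      by (intro sum.mono_neutral_right) (auto simp: fluid_inactive_def)
    then show ?thesis using disj by (simp add: sum.union_disjoint)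
  qed
  have act: "(\<Sum>s\<in>fluid_active x t. fluid_state x t s) = (\<Sum>s\<in>fluid_active x t. x t s True)"
    by (intro sum.cong) (auto simp: fluid_state_split fluid_active_def)
  have scaled: "real N * \<delta> \<le> real N * (\<Sum>s\<in>fluid_neutral x t. x t s a)" for a
    using d by (cases a) (auto intro: mult_left_mono)
  have "real N * \<delta> \<le> ?d"
    using L X
  proof (cases rule: fluid_priority_cases)
    case active
    have "ratio M t * real N = (\<Sum>s\<in>fluid_active x t. real (X s))"
      unfolding total[symmetric] using active by (intro sum.mono_neutral_right) auto
    also have "\<dots> \<le> (\<Sum>s\<in>fluid_active x t. real (Z s))" by (intro sum_mono XZ')
    finally show ?thesis
      using dev_part[of "fluid_active x t"] scaled[of True] unfolding act x_split
      by (simp add: algebra_simps abs_le_iff)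
  next
    case inactive
    let ?S = "fluid_active x t \<union> fluid_neutral x t"
    have "(\<Sum>s\<in>?S. real (Z s)) = (\<Sum>s\<in>?S. real (X s))"
      using inactive by (intro sum.cong) auto
    also have "\<dots> \<le> ratio M t * real N" unfolding total[symmetric] by (intro sum_mono2) auto
    finally have "(\<Sum>s\<in>?S. real (Z s)) \<le> ratio M t * real N" .
    moreover have "(\<Sum>s\<in>?S. fluid_state x t s) = ratio M t + (\<Sum>s\<in>fluid_neutral x t. x t s False)"
      unfolding x_split using disj act
      by (simp add: sum.union_disjoint fluid_state_split sum.distrib)
    ultimately show ?thesis
      using dev_part[of ?S] scaled[of False] by (simp add: algebra_simps abs_le_iff)
  qed (use False in auto)
  then have "(real N * \<delta>)\<^sup>2 \<le> ?d\<^sup>2" using \<open>0 \<le> \<delta>\<close> by (intro power_mono) auto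
  moreover have "?D * (\<delta>\<^sup>2 * real N) \<le> real N * (\<delta>\<^sup>2 * real N)"
    by (intro mult_right_mono DN) simp
  ultimately show ?thesis by (simp add: power2_eq_square algebra_simps)
qed

end

section \<open>Deviations from the fluid over time\<close>

lemma fluid_deviation_bounded:
  "\<bar>fluid_deviation x N t (state_count N \<sigma>)\<bar> \<le> (\<Sum>s\<in>UNIV. real N + \<bar>real N * fluid_state x t s\<bar>)"
proof -
  have "\<bar>real (state_count N \<sigma> s) - real N * fluid_state x t s\<bar>
      \<le> real N + \<bar>real N * fluid_state x t s\<bar>" for s
    using state_count_le[of N \<sigma> s] by linarith
  then have "fluid_deviation x N t (state_count N \<sigma>) \<le> (\<Sum>s\<in>UNIV. real N + \<bar>real N * fluid_state x t s\<bar>)"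
    unfolding fluid_deviation_def by (rule sum_mono)
  moreover have "0 \<le> fluid_deviation x N t (state_count N \<sigma>)"
    by (simp add: fluid_deviation_def sum_nonneg)
  ultimately show ?thesis by simp
qed

lemma fluid_deviation_squared_bounded:
  "\<bar>(fluid_deviation x N t (state_count N \<sigma>))\<^sup>2\<bar> \<le> (\<Sum>s\<in>UNIV. real N + \<bar>real N * fluid_state x t s\<bar>)\<^sup>2"
proof -
  have "\<bar>fluid_deviation x N t (state_count N \<sigma>)\<bar>\<^sup>2 \<le> (\<Sum>s\<in>UNIV. real N + \<bar>real N * fluid_state x t s\<bar>)\<^sup>2"
    by (intro power_mono fluid_deviation_bounded) simp
  then show ?thesis by simp
qed

lemma square_sum_le: "(u + v)\<^sup>2 \<le> 2 * u\<^sup>2 + 2 * v\<^sup>2" for u v :: real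
  using zero_le_power2[of "u - v"] by (simp add: power2_sum power2_diff)

lemma next_state_mean_lipschitz:
  fixes X Y :: "'s::finite \<Rightarrow> bool \<Rightarrow> real"
  shows "(\<Sum>s\<in>UNIV. \<bar>next_state_mean M t X s - next_state_mean M t Y s\<bar>) \<le>
    (\<Sum>b\<in>UNIV. \<Sum>s\<in>UNIV. \<bar>X s b - Y s b\<bar>)"
proof -
  have "(\<Sum>s\<in>UNIV. \<bar>next_state_mean M t X s - next_state_mean M t Y s\<bar>) =
      (\<Sum>s\<in>UNIV. \<bar>\<Sum>b\<in>UNIV. \<Sum>s'\<in>UNIV. (X s' b - Y s' b) * pmf (kernel M t s' b) s\<bar>)"
    by (simp add: next_state_mean_def sum_subtractf[symmetric] left_diff_distrib del: sum_subtractf)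
  also have "\<dots> \<le> (\<Sum>s\<in>UNIV. \<Sum>b\<in>UNIV. \<Sum>s'\<in>UNIV. \<bar>X s' b - Y s' b\<bar> * pmf (kernel M t s' b) s)"
    by (intro sum_mono order_trans[OF sum_abs] order_trans[OF sum_abs]) (simp add: abs_mult)
  also have "\<dots> = (\<Sum>b\<in>UNIV. \<Sum>s\<in>UNIV. \<Sum>s'\<in>UNIV. \<bar>X s' b - Y s' b\<bar> * pmf (kernel M t s' b) s)"
    by (rule sum.swap)
  also have "\<dots> = (\<Sum>b\<in>UNIV. \<Sum>s'\<in>UNIV. \<Sum>s\<in>UNIV. \<bar>X s' b - Y s' b\<bar> * pmf (kernel M t s' b) s)"
    by (intro sum.cong refl sum.swap)
  also have "\<dots> = (\<Sum>b\<in>UNIV. \<Sum>s\<in>UNIV. \<bar>X s b - Y s b\<bar>)"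
    by (simp add: sum_pmf_eq_1 flip: sum_distrib_left)
  finally show ?thesis .
qed

lemma fluid_state_Suc:
  assumes "feasible_occupation M x" and "Suc k \<in> epochs M" and "Suc (Suc k) \<in> epochs M"
  shows "fluid_state x (Suc (Suc k)) s = next_state_mean M (Suc k) (x (Suc k)) s"
  using assms by (simp add: feasible_occupation_def fluid_state_def next_state_mean_def epochs_def)

text \<open>
  The deviation after a transition is at most the fluctuation around the conditional mean plus the
  deviation of the action counts, which the kernel does not increase.  The fluctuation is a sum over
  states of centred counts with variance at most \<open>N\<close>; passing from its square to the sum of squares
  costs a factor, the number of states.
\<close>
lemma next_deviation_moment:
  fixes M :: "'s::finite bandit"
  assumes "feasible_occupation M x" and "Suc k \<in> epochs M" and "Suc (Suc k) \<in> epochs M"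
  shows "measure_pmf.expectation (next_states M N (Suc k) (\<sigma>, a))
      (\<lambda>\<sigma>'. (fluid_deviation x N (Suc (Suc k)) (state_count N \<sigma>'))\<^sup>2) \<le>
    2 * (real CARD('s))\<^sup>2 * real N +
    2 * (\<Sum>b\<in>UNIV. \<Sum>s\<in>UNIV. \<bar>real (action_count N \<sigma> a s b) - real N * x (Suc k) s b\<bar>)\<^sup>2"
proof -
  let ?p = "next_states M N (Suc k) (\<sigma>, a)"
  let ?A = "\<Sum>b\<in>UNIV. \<Sum>s\<in>UNIV. \<bar>real (action_count N \<sigma> a s b) - real N * x (Suc k) s b\<bar>"
  define m where "m = next_state_mean M (Suc k) (\<lambda>s b. real (action_count N \<sigma> a s b))"
  have target: "real N * fluid_state x (Suc (Suc k)) s =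
      next_state_mean M (Suc k) (\<lambda>s b. real N * x (Suc k) s b) s" for s
    unfolding fluid_state_Suc[OF assms] by (simp add: next_state_mean_def sum_distrib_left mult.assoc)
  let ?noise = "\<lambda>\<sigma>'. \<Sum>s\<in>UNIV. \<bar>real (state_count N \<sigma>' s) - m s\<bar>"
  let ?sq = "\<lambda>\<sigma>' s. (real (state_count N \<sigma>' s) - m s)\<^sup>2"
  have int: "integrable (measure_pmf ?p) (\<lambda>\<sigma>'. ?sq \<sigma>' s)" for s
  proof (rule integrable_pmf_bounded)
    fix \<sigma>'
    have "\<bar>real (state_count N \<sigma>' s) - m s\<bar> \<le> real N + \<bar>m s\<bar>"
      using state_count_le[of N \<sigma>' s] by linarith
    then have "\<bar>real (state_count N \<sigma>' s) - m s\<bar>\<^sup>2 \<le> (real N + \<bar>m s\<bar>)\<^sup>2" by (rule power_mono) simp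
    then show "\<bar>?sq \<sigma>' s\<bar> \<le> (real N + \<bar>m s\<bar>)\<^sup>2" by simp
  qed
  have pointwise: "(fluid_deviation x N (Suc (Suc k)) (state_count N \<sigma>'))\<^sup>2 \<le>
      2 * real CARD('s) * (\<Sum>s\<in>UNIV. ?sq \<sigma>' s) + 2 * ?A\<^sup>2" for \<sigma>'
  proof -
    have "fluid_deviation x N (Suc (Suc k)) (state_count N \<sigma>') \<le>
        (\<Sum>s\<in>UNIV. \<bar>real (state_count N \<sigma>' s) - m s\<bar> + \<bar>m s - real N * fluid_state x (Suc (Suc k)) s\<bar>)"
      unfolding fluid_deviation_def by (intro sum_mono) linarith
    also have "\<dots> \<le> ?noise \<sigma>' + ?A"
      unfolding sum.distrib target m_def by (intro add_left_mono next_state_mean_lipschitz)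
    finally have "(fluid_deviation x N (Suc (Suc k)) (state_count N \<sigma>'))\<^sup>2 \<le> (?noise \<sigma>' + ?A)\<^sup>2"
      by (rule power_mono) (simp add: fluid_deviation_def sum_nonneg)
    also have "\<dots> \<le> 2 * (?noise \<sigma>')\<^sup>2 + 2 * ?A\<^sup>2" by (rule square_sum_le)
    also have "(?noise \<sigma>')\<^sup>2 \<le> real CARD('s) * (\<Sum>s\<in>UNIV. ?sq \<sigma>' s)"
      using sum_squared_le_sum_of_squares[of "\<lambda>s. \<bar>real (state_count N \<sigma>' s) - m s\<bar>" UNIV]
      by (simp add: mult.commute)
    finally show ?thesis by simp
  qed
  have "measure_pmf.expectation ?p
      (\<lambda>\<sigma>'. (fluid_deviation x N (Suc (Suc k)) (state_count N \<sigma>'))\<^sup>2) \<le>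
    measure_pmf.expectation ?p (\<lambda>\<sigma>'. 2 * real CARD('s) * (\<Sum>s\<in>UNIV. ?sq \<sigma>' s) + 2 * ?A\<^sup>2)"
    using int by (intro integral_mono pointwise integrable_pmf_bounded[OF fluid_deviation_squared_bounded])
      auto
  also have "\<dots> = 2 * real CARD('s) * (\<Sum>s\<in>UNIV. measure_pmf.expectation ?p (\<lambda>\<sigma>'. ?sq \<sigma>' s)) + 2 * ?A\<^sup>2"
    using int by simp
  also have "(\<Sum>s\<in>(UNIV :: 's set). measure_pmf.expectation ?p (\<lambda>\<sigma>'. ?sq \<sigma>' s)) \<le> (\<Sum>s\<in>(UNIV :: 's set). real N)"
    unfolding m_def by (intro sum_mono next_state_count_moments(2))
  finally show ?thesis by (simp add: power2_eq_square mult.assoc mult_left_mono)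
qed

section \<open>Mass on unused actions\<close>

definition unused_mass :: "'s::finite occupation \<Rightarrow> 's occupation \<Rightarrow> nat \<Rightarrow> real" where
  "unused_mass x y t = (\<Sum>s\<in>UNIV. \<Sum>b\<in>UNIV. of_bool (x t s b = 0) * y t s b)"

text \<open>
  Idling in such a state is unused by the fluid as well, although the state counts as
  fluid-inactive; these pairs are not covered by the bound on misplaced arms.
\<close>
definition null_states :: "'s::finite occupation \<Rightarrow> nat \<Rightarrow> 's set" where
  "null_states x t = {s. fluid_state x t s = 0}"

lemma null_states_mass_first:
  fixes M :: "'s::finite bandit"
  assumes "feasible_occupation M x" and "feasible_occupation M y" and "1 \<in> epochs M"
  shows "(\<Sum>s\<in>null_states x 1. fluid_state y 1 s) = 0"
proof -
  have init: "fluid_state x 1 (init M) = 1" "fluid_state y 1 (init M) = 1"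
    and total: "(\<Sum>s\<in>UNIV. fluid_state y 1 s) = 1"
    using assms by (simp_all add: feasible_occupation_def fluid_state_def)
  have nonneg: "0 \<le> fluid_state y 1 s" for s
    using assms by (auto simp: feasible_occupation_def fluid_state_def intro!: sum_nonneg)
  have "(\<Sum>s\<in>UNIV - {init M}. fluid_state y 1 s) = 0"
    using total init(2) by (simp add: sum.remove[of UNIV "init M"])
  then have "fluid_state y 1 s = 0" if "s \<noteq> init M" for s
    using that nonneg by (subst (asm) sum_nonneg_eq_0_iff) auto
  moreover have "s \<noteq> init M" if "s \<in> null_states x 1" for s
    using that init(1) by (auto simp: null_states_def)
  ultimately show ?thesis by (intro sum.neutral) blast
qed

text \<open>
  A state without fluid mass is reachable only from pairs \<open>(s', b)\<close> with \<open>x t s' b = 0\<close>.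
\<close>
lemma null_states_mass_Suc:
  fixes M :: "'s::finite bandit"
  assumes x: "feasible_occupation M x" and y: "feasible_occupation M y"
    and t: "Suc k \<in> epochs M" "Suc (Suc k) \<in> epochs M"
  shows "(\<Sum>s\<in>null_states x (Suc (Suc k)). fluid_state y (Suc (Suc k)) s) \<le> unused_mass x y (Suc k)"
proof -
  let ?t = "Suc k" and ?null = "null_states x (Suc (Suc k))"
  have nonneg: "0 \<le> x ?t s b" "0 \<le> y ?t s b" for s b
    using x y t by (auto simp: feasible_occupation_def)
  let ?q = "\<lambda>s' b s. pmf (kernel M ?t s' b) s"
  \<comment> \<open>the two sides differ only where \<open>x\<close> has mass, and from there the state is not reached\<close>
  have entry: "y ?t s' b * ?q s' b s \<le> of_bool (x ?t s' b = 0) * y ?t s' b * ?q s' b s"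
    if "s \<in> ?null" for s s' b
  proof -
    have "(\<Sum>b\<in>UNIV. \<Sum>s'\<in>UNIV. x ?t s' b * ?q s' b s) = 0"
      using that fluid_state_Suc[OF x t, of s] by (simp add: null_states_def next_state_mean_def)
    then have "\<forall>b\<in>UNIV. (\<Sum>s'\<in>UNIV. x ?t s' b * ?q s' b s) = 0"
      by (subst (asm) sum_nonneg_eq_0_iff) (auto intro!: sum_nonneg mult_nonneg_nonneg nonneg)
    then have "(\<Sum>s'\<in>UNIV. x ?t s' b * ?q s' b s) = 0" by blast
    then have "\<forall>s'\<in>UNIV. x ?t s' b * ?q s' b s = 0"
      by (subst (asm) sum_nonneg_eq_0_iff) (auto intro!: mult_nonneg_nonneg nonneg)
    then have "x ?t s' b = 0 \<or> ?q s' b s = 0" by simp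
    then show ?thesis by auto
  qed
  have "(\<Sum>s\<in>?null. fluid_state y (Suc (Suc k)) s) =
      (\<Sum>s\<in>?null. \<Sum>b\<in>UNIV. \<Sum>s'\<in>UNIV. y ?t s' b * ?q s' b s)"
    unfolding fluid_state_Suc[OF y t] next_state_mean_def ..
  also have "\<dots> \<le> (\<Sum>s\<in>?null. \<Sum>b\<in>UNIV. \<Sum>s'\<in>UNIV. of_bool (x ?t s' b = 0) * y ?t s' b * ?q s' b s)"
    by (intro sum_mono entry)
  also have "\<dots> \<le> (\<Sum>s\<in>UNIV. \<Sum>b\<in>UNIV. \<Sum>s'\<in>UNIV. of_bool (x ?t s' b = 0) * y ?t s' b * ?q s' b s)"
    by (intro sum_mono2) (auto intro!: sum_nonneg mult_nonneg_nonneg nonneg)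
  also have "\<dots> = (\<Sum>b\<in>UNIV. \<Sum>s'\<in>UNIV. \<Sum>s\<in>UNIV. of_bool (x ?t s' b = 0) * y ?t s' b * ?q s' b s)"
    by (subst sum.swap) (intro sum.cong refl sum.swap)
  also have "\<dots> = (\<Sum>b\<in>UNIV. \<Sum>s'\<in>UNIV. of_bool (x ?t s' b = 0) * y ?t s' b)"
    by (simp add: sum_pmf_eq_1 flip: sum_distrib_left)
  also have "\<dots> = unused_mass x y ?t" unfolding unused_mass_def by (rule sum.swap)
  finally show ?thesis .
qed

context
  fixes M :: "'s::finite bandit" and x :: "'s occupation"
    and P :: "nat \<Rightarrow> 's \<Rightarrow> real" and L :: "nat \<Rightarrow> 's list"
  assumes valid: "valid_ratios M" and feas: "feasible_occupation M x"
    and L: "\<forall>t\<in>epochs M. visiting_order (P t) (L t)"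
begin

lemma realized_counts:
  assumes N: "admissible_size M N" and \<phi>: "realizes M N (fluid_priority M x L N) \<phi>"
    and t: "Suc k \<in> epochs M" and supp: "(\<sigma>, a) \<in> set_pmf (decision_law M N \<phi> (Suc k))"
  defines "X \<equiv> fluid_priority_pulls M x L N (Suc k) (state_count N \<sigma>)"
  shows "action_count N \<sigma> a s True = X s"
    and "action_count N \<sigma> a s False = state_count N \<sigma> s - X s"
    and "X s \<le> state_count N \<sigma> s"
    and "(\<Sum>s\<in>UNIV. real (X s)) = ratio M (Suc k) * real N"
proof -
  have "action_count N \<sigma> a = fluid_priority M x L N (Suc k) (state_count N \<sigma>)"
    using \<phi> t set_decision_law[OF supp] by (simp add: realizes_def)
  then show counts: "action_count N \<sigma> a s True = X s"
    "action_count N \<sigma> a s False = state_count N \<sigma> s - X s" for s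
    by (simp_all add: fluid_priority_def X_def)
  show "X s \<le> state_count N \<sigma> s"
    using sum_action_count[of N \<sigma> a s] counts by (simp add: UNIV_bool)
  have "(\<Sum>s\<in>UNIV. X s) = budget M N (Suc k)"
    using fluid_priority_valid[OF valid N feas L] t state_count_sum[of N \<sigma>]
    by (simp add: valid_count_policy_def fluid_priority_def X_def)
  moreover have "real (budget M N (Suc k)) = ratio M (Suc k) * real N"
  proof -
    have "0 \<le> ratio M (Suc k)" "ratio M (Suc k) * real N \<in> \<int>"
      using valid N t by (simp_all add: valid_ratios_def admissible_size_def)
    then show ?thesis unfolding budget_def by (auto elim!: Ints_cases)
  qed
  ultimately show "(\<Sum>s\<in>UNIV. real (X s)) = ratio M (Suc k) * real N"
    by (metis of_nat_sum)
qed

lemma visiting_set: "t \<in> epochs M \<Longrightarrow> set (L t) = UNIV"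
  using L by (auto simp: visiting_order_def)

text \<open>
  The idle count of a state is its arm count minus its pulls.  This costs one deviation in
  addition to the bound on the pulls, which is used for both actions.
\<close>
lemma realized_occupation_deviation:
  assumes "admissible_size M N" and "realizes M N (fluid_priority M x L N) \<phi>"
    and t: "Suc k \<in> epochs M" and "(\<sigma>, a) \<in> set_pmf (decision_law M N \<phi> (Suc k))"
  shows "(\<Sum>b\<in>UNIV. \<Sum>s\<in>UNIV. \<bar>real (action_count N \<sigma> a s b) - real N * x (Suc k) s b\<bar>) \<le>
    5 * fluid_deviation x N (Suc k) (state_count N \<sigma>) + 4 * real CARD('s)"
proof -
  let ?X = "fluid_priority_pulls M x L N (Suc k) (state_count N \<sigma>)"
  note counts = realized_counts[OF assms]
  let ?T = "\<Sum>s\<in>UNIV. \<bar>real (?X s) - real N * x (Suc k) s True\<bar>"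
  have pulls: "?T \<le> 2 * (fluid_deviation x N (Suc k) (state_count N \<sigma>) + real CARD('s))"
    by (rule pulls_near_fluid[OF feas t visiting_set[OF t] refl counts(3,4)])
  have "\<bar>real (state_count N \<sigma> s - ?X s) - real N * x (Suc k) s False\<bar> \<le>
      \<bar>real (state_count N \<sigma> s) - real N * fluid_state x (Suc k) s\<bar> +
      \<bar>real (?X s) - real N * x (Suc k) s True\<bar>" for s
    using counts(3)[of s] by (simp add: fluid_state_def UNIV_bool of_nat_diff distrib_left)
  then have "(\<Sum>s\<in>UNIV. \<bar>real (state_count N \<sigma> s - ?X s) - real N * x (Suc k) s False\<bar>) \<le>
      fluid_deviation x N (Suc k) (state_count N \<sigma>) + ?T"
    unfolding fluid_deviation_def sum.distrib[symmetric] by (rule sum_mono)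
  then show ?thesis using pulls by (simp add: UNIV_bool counts(1,2))
qed

text \<open>
  All arms start in the same state, so the first deviation is \<open>0\<close>.  One transition turns a bound
  \<open>C * N\<close> into another such bound, with a constant that depends on neither \<open>N\<close> nor the realization.
\<close>
lemma deviation_moment_bound:
  assumes "Suc k \<in> epochs M"
  shows "\<exists>C. \<forall>N \<phi>. admissible_size M N \<longrightarrow> realizes M N (fluid_priority M x L N) \<phi> \<longrightarrow>
    measure_pmf.expectation (state_law M N \<phi> (Suc k))
      (\<lambda>\<sigma>. (fluid_deviation x N (Suc k) (state_count N \<sigma>))\<^sup>2) \<le> C * real N"
  using assms
proof (induction k)
  case 0
  have "fluid_deviation x N (Suc 0) (state_count N (\<lambda>_. init M)) = 0" for N
  proof -
    have "fluid_state x 1 s = of_bool (s = init M)" for s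
    proof (cases "s = init M")
      case True
      then show ?thesis using feas by (simp add: feasible_occupation_def fluid_state_def)
    next
      case False
      have nonneg: "0 \<le> fluid_state x 1 s" for s
        using feas 0 by (auto simp: feasible_occupation_def fluid_state_def intro!: sum_nonneg)
      have "(\<Sum>s\<in>UNIV. fluid_state x 1 s) = fluid_state x 1 (init M)"
        using feas by (simp add: feasible_occupation_def fluid_state_def)
      then have "(\<Sum>s\<in>UNIV - {init M}. fluid_state x 1 s) = 0"
        by (simp add: sum.remove[of UNIV "init M"])
      then show ?thesis using False nonneg by (subst (asm) sum_nonneg_eq_0_iff) auto
    qed
    then show ?thesis
      by (auto simp: fluid_deviation_def state_count_def intro!: sum.neutral)
  qed
  then show ?case by (intro exI[of _ 0]) (simp add: state_law_1)
next
  case (Suc k)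
  then have t: "Suc k \<in> epochs M" "Suc (Suc k) \<in> epochs M" by (auto simp: epochs_def)
  let ?S = "real CARD('s)"
  obtain C where C: "\<And>N \<phi>. admissible_size M N \<Longrightarrow> realizes M N (fluid_priority M x L N) \<phi> \<Longrightarrow>
    measure_pmf.expectation (state_law M N \<phi> (Suc k))
      (\<lambda>\<sigma>. (fluid_deviation x N (Suc k) (state_count N \<sigma>))\<^sup>2) \<le> C * real N"
    using Suc.IH[OF t(1)] by blast
  have "measure_pmf.expectation (state_law M N \<phi> (Suc (Suc k)))
      (\<lambda>\<sigma>. (fluid_deviation x N (Suc (Suc k)) (state_count N \<sigma>))\<^sup>2) \<le> (66 * ?S\<^sup>2 + 100 * C) * real N"
    if N: "admissible_size M N" and \<phi>: "realizes M N (fluid_priority M x L N) \<phi>" for N \<phi>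
  proof -
    let ?d = "\<lambda>t \<sigma>. fluid_deviation x N t (state_count N \<sigma>)"
    have step: "measure_pmf.expectation (next_states M N (Suc k) y) (\<lambda>\<sigma>'. (?d (Suc (Suc k)) \<sigma>')\<^sup>2)
        \<le> 2 * ?S\<^sup>2 * real N + 100 * (?d (Suc k) (fst y))\<^sup>2 + 64 * ?S\<^sup>2"
      if "y \<in> set_pmf (decision_law M N \<phi> (Suc k))" for y
    proof -
      obtain \<sigma> a where y: "y = (\<sigma>, a)" by fastforce
      let ?A = "\<Sum>b\<in>UNIV. \<Sum>s\<in>UNIV. \<bar>real (action_count N \<sigma> a s b) - real N * x (Suc k) s b\<bar>"
      have "?A \<le> 5 * ?d (Suc k) \<sigma> + 4 * ?S"
        using realized_occupation_deviation[OF N \<phi> t(1)] that by (simp add: y)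
      then have "?A\<^sup>2 \<le> (5 * ?d (Suc k) \<sigma> + 4 * ?S)\<^sup>2"
        by (rule power_mono) (auto intro!: sum_nonneg)
      also have "\<dots> \<le> 2 * (5 * ?d (Suc k) \<sigma>)\<^sup>2 + 2 * (4 * ?S)\<^sup>2" by (rule square_sum_le)
      finally show ?thesis
        using next_deviation_moment[OF feas t, of N \<sigma> a] by (simp add: y power_mult_distrib)
    qed
    have int: "integrable (measure_pmf (decision_law M N \<phi> (Suc k))) (\<lambda>y. (?d (Suc k) (fst y))\<^sup>2)"
      by (rule integrable_pmf_bounded, rule fluid_deviation_squared_bounded)
    have "measure_pmf.expectation (state_law M N \<phi> (Suc (Suc k))) (\<lambda>\<sigma>. (?d (Suc (Suc k)) \<sigma>)\<^sup>2) =
        measure_pmf.expectation (decision_law M N \<phi> (Suc k))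
          (\<lambda>y. measure_pmf.expectation (next_states M N (Suc k) y) (\<lambda>\<sigma>'. (?d (Suc (Suc k)) \<sigma>')\<^sup>2))"
      unfolding state_law_Suc by (rule expectation_bind_pmf[OF fluid_deviation_squared_bounded])
    also have "\<dots> \<le> measure_pmf.expectation (decision_law M N \<phi> (Suc k))
        (\<lambda>y. 2 * ?S\<^sup>2 * real N + 100 * (?d (Suc k) (fst y))\<^sup>2 + 64 * ?S\<^sup>2)"
    proof (rule integral_mono_AE)
      let ?B = "(\<Sum>s\<in>UNIV. real N + \<bar>real N * fluid_state x (Suc (Suc k)) s\<bar>)\<^sup>2"
      show "integrable (measure_pmf (decision_law M N \<phi> (Suc k)))
        (\<lambda>y. measure_pmf.expectation (next_states M N (Suc k) y) (\<lambda>\<sigma>'. (?d (Suc (Suc k)) \<sigma>')\<^sup>2))"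
      proof (rule integrable_pmf_bounded)
        fix y
        have "measure_pmf.expectation (next_states M N (Suc k) y) (\<lambda>\<sigma>'. (?d (Suc (Suc k)) \<sigma>')\<^sup>2) \<le> ?B"
          using fluid_deviation_squared_bounded[of x N "Suc (Suc k)"]
          by (intro measure_pmf.integral_le_const
              integrable_pmf_bounded[OF fluid_deviation_squared_bounded]) auto
        then show "\<bar>measure_pmf.expectation (next_states M N (Suc k) y)
            (\<lambda>\<sigma>'. (?d (Suc (Suc k)) \<sigma>')\<^sup>2)\<bar> \<le> ?B"
          by (subst abs_of_nonneg) (auto intro!: Bochner_Integration.integral_nonneg)
      qed
      show "integrable (measure_pmf (decision_law M N \<phi> (Suc k)))
        (\<lambda>y. 2 * ?S\<^sup>2 * real N + 100 * (?d (Suc k) (fst y))\<^sup>2 + 64 * ?S\<^sup>2)"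
        by (intro Bochner_Integration.integrable_add integrable_mult_right int) simp_all
    qed (use step in \<open>simp add: AE_measure_pmf_iff\<close>)
    also have "\<dots> = 2 * ?S\<^sup>2 * real N + 64 * ?S\<^sup>2 +
        100 * measure_pmf.expectation (state_law M N \<phi> (Suc k)) (\<lambda>\<sigma>. (?d (Suc k) \<sigma>)\<^sup>2)"
      using int by (simp flip: decision_law_fst)
    also have "\<dots> \<le> 2 * ?S\<^sup>2 * real N + 64 * ?S\<^sup>2 * real N + 100 * (C * real N)"
    proof -
      \<comment> \<open>the rounding errors do not grow with \<open>N\<close>; they are absorbed since \<open>N \<ge> 1\<close>\<close>
      have "64 * ?S\<^sup>2 * 1 \<le> 64 * ?S\<^sup>2 * real N"
        using N by (intro mult_left_mono) (auto simp: admissible_size_def)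
      then show ?thesis using C[OF N \<phi>] by linarith
    qed
    finally show ?thesis by (simp add: algebra_simps)
  qed
  then show ?case by blast
qed

lemma realized_relaxed:
  assumes N: "admissible_size M N" and \<phi>: "realizes M N (fluid_priority M x L N) \<phi>"
  shows "relaxed_policy M N \<phi>"
proof -
  have N0: "0 < N" using N by (simp add: admissible_size_def)
  have "(\<Sum>s\<in>UNIV. mean_occupation M N \<phi> t s True) = ratio M t" if t: "t \<in> epochs M" for t
  proof -
    obtain k where k: "t = Suc k" using t by (cases t) (auto simp: epochs_def)
    have "real N * (\<Sum>s\<in>UNIV. mean_occupation M N \<phi> t s True) =
        measure_pmf.expectation (decision_law M N \<phi> t)
          (\<lambda>(\<sigma>, a). \<Sum>b\<in>UNIV. \<Sum>s\<in>UNIV. real (action_count N \<sigma> a s b) * of_bool b)"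
      unfolding mean_occupation_linear[OF N0] by (simp add: UNIV_bool)
    also have "\<dots> = measure_pmf.expectation (decision_law M N \<phi> t) (\<lambda>_. ratio M t * real N)"
      using realized_counts[OF N \<phi>] t
      by (intro expectation_pmf_cong) (auto simp: k UNIV_bool)
    finally show ?thesis using N0 by simp
  qed
  then show ?thesis using N0 by (simp add: relaxed_policy_iff)
qed

context
  assumes nondeg: "nondegenerate M x"
begin

text \<open>
  The unused pairs are those with a misplaced arm and the idle actions in null states.  Subtracting
  the whole mass of the null states from the unused mass leaves at most the misplaced arms,
  whose mean is controlled by the second moment of the deviation.
\<close>
lemma unused_mass_step:
  assumes t: "Suc k \<in> epochs M"
  shows "\<exists>C. \<forall>N \<phi>. admissible_size M N \<longrightarrow> realizes M N (fluid_priority M x L N) \<phi> \<longrightarrow>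
    unused_mass x (mean_occupation M N \<phi>) (Suc k) \<le>
      C / real N + (\<Sum>s\<in>null_states x (Suc k). fluid_state (mean_occupation M N \<phi>) (Suc k) s)"
proof -
  let ?t = "Suc k"
  define \<delta> where "\<delta> = min (\<Sum>s\<in>fluid_neutral x ?t. x ?t s True) (\<Sum>s\<in>fluid_neutral x ?t. x ?t s False)"
  have "fluid_neutral x ?t \<noteq> {}" using nondeg t by (force simp: nondegenerate_def)
  then have \<delta>: "0 < \<delta>" unfolding \<delta>_def by (auto simp: fluid_neutral_def intro!: sum_pos)
  obtain C where C: "\<And>N \<phi>. admissible_size M N \<Longrightarrow> realizes M N (fluid_priority M x L N) \<phi> \<Longrightarrow>
    measure_pmf.expectation (state_law M N \<phi> ?t)
      (\<lambda>\<sigma>. (fluid_deviation x N ?t (state_count N \<sigma>))\<^sup>2) \<le> C * real N"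
    using deviation_moment_bound[OF t] by blast
  have "unused_mass x (mean_occupation M N \<phi>) ?t \<le>
      (C / \<delta>\<^sup>2) / real N + (\<Sum>s\<in>null_states x ?t. fluid_state (mean_occupation M N \<phi>) ?t s)"
    if N: "admissible_size M N" and \<phi>: "realizes M N (fluid_priority M x L N) \<phi>" for N \<phi>
  proof -
    have N0: "0 < N" using N by (simp add: admissible_size_def)
    let ?y = "mean_occupation M N \<phi>"
    let ?d = "\<lambda>\<sigma>. fluid_deviation x N ?t (state_count N \<sigma>)"
    let ?unused = "\<lambda>s b. of_bool (x ?t s b = 0) :: real"
    let ?null = "\<lambda>s. of_bool (s \<in> null_states x ?t) :: real"
    have pointwise: "(case y of (\<sigma>, a) \<Rightarrow> \<Sum>b\<in>UNIV. \<Sum>s\<in>UNIV. real (action_count N \<sigma> a s b) * (?unused s b - ?null s))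
        \<le> (?d (fst y))\<^sup>2 / (\<delta>\<^sup>2 * real N)" if supp: "y \<in> set_pmf (decision_law M N \<phi> ?t)" for y
    proof -
      obtain \<sigma> a where y: "y = (\<sigma>, a)" by fastforce
      let ?X = "fluid_priority_pulls M x L N ?t (state_count N \<sigma>)"
      note counts = realized_counts[OF N \<phi> t supp[unfolded y]]
      have nonneg: "0 \<le> x ?t s b" for s b using feas t by (simp add: feasible_occupation_def)
      have null: "s \<in> null_states x ?t \<longleftrightarrow> x ?t s True = 0 \<and> x ?t s False = 0" for s
        using nonneg[of s True] nonneg[of s False]
        by (auto simp: null_states_def fluid_state_def UNIV_bool)
      have "(\<Sum>b\<in>UNIV. \<Sum>s\<in>UNIV. real (action_count N \<sigma> a s b) * (?unused s b - ?null s)) \<le>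
          (\<Sum>s\<in>UNIV. of_bool (s \<in> fluid_inactive x ?t) * real (?X s)) +
          (\<Sum>s\<in>UNIV. of_bool (s \<in> fluid_active x ?t) * (real (state_count N \<sigma> s) - real (?X s)))"
      proof -
        have "(\<Sum>b\<in>UNIV. real (action_count N \<sigma> a s b) * (?unused s b - ?null s)) \<le>
            of_bool (s \<in> fluid_inactive x ?t) * real (?X s) +
            of_bool (s \<in> fluid_active x ?t) * (real (state_count N \<sigma> s) - real (?X s))" for s
        proof -
          have "x ?t s True = 0 \<or> 0 < x ?t s True" using nonneg[of s True] by linarith
          then show ?thesis using counts(3)[of s]
            by (cases "x ?t s False = 0")
              (auto simp: UNIV_bool counts(1,2) null fluid_inactive_def fluid_active_def of_nat_diff)
        qed
        then have "(\<Sum>s\<in>UNIV. \<Sum>b\<in>UNIV. real (action_count N \<sigma> a s b) * (?unused s b - ?null s)) \<le>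
            (\<Sum>s\<in>UNIV. of_bool (s \<in> fluid_inactive x ?t) * real (?X s) +
              of_bool (s \<in> fluid_active x ?t) * (real (state_count N \<sigma> s) - real (?X s)))"
          by (rule sum_mono)
        then show ?thesis unfolding sum.distrib by (subst sum.swap)
      qed
      also have "\<dots> = (\<Sum>s\<in>fluid_inactive x ?t. real (?X s)) +
          (\<Sum>s\<in>fluid_active x ?t. real (state_count N \<sigma> s) - real (?X s))"
        by (simp add: sum_of_bool_mult_eq)
      also have "\<dots> \<le> (?d \<sigma>)\<^sup>2 / (\<delta>\<^sup>2 * real N)"
      proof -
        have "((\<Sum>s\<in>fluid_inactive x ?t. real (?X s)) +
            (\<Sum>s\<in>fluid_active x ?t. real (state_count N \<sigma> s) - real (?X s))) * (\<delta>\<^sup>2 * real N) \<le> (?d \<sigma>)\<^sup>2"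
          by (rule misplaced_arms_bound[OF feas t visiting_set[OF t] refl counts(3,4)])
            (use \<delta> state_count_sum[of N \<sigma>] in \<open>auto simp: \<delta>_def\<close>)
        then show ?thesis using \<delta> N0 by (subst pos_le_divide_eq) auto
      qed
      finally show ?thesis by (simp add: y)
    qed
    have "real N * (unused_mass x ?y ?t - (\<Sum>s\<in>null_states x ?t. fluid_state ?y ?t s)) =
        real N * (\<Sum>b\<in>UNIV. \<Sum>s\<in>UNIV. ?y ?t s b * (?unused s b - ?null s))"
    proof -
      have "(\<Sum>s\<in>null_states x ?t. fluid_state ?y ?t s) = (\<Sum>s\<in>UNIV. \<Sum>b\<in>UNIV. ?null s * ?y ?t s b)"
        unfolding fluid_state_def sum_distrib_left[symmetric]
        by (simp add: sum_of_bool_mult_eq)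
      then show ?thesis
        unfolding unused_mass_def by (subst sum.swap) (simp add: algebra_simps sum_subtractf)
    qed
    also have "\<dots> = measure_pmf.expectation (decision_law M N \<phi> ?t)
        (\<lambda>(\<sigma>, a). \<Sum>b\<in>UNIV. \<Sum>s\<in>UNIV. real (action_count N \<sigma> a s b) * (?unused s b - ?null s))"
      by (rule mean_occupation_linear[OF N0, symmetric])
    also have "\<dots> \<le> measure_pmf.expectation (decision_law M N \<phi> ?t) (\<lambda>y. (?d (fst y))\<^sup>2 / (\<delta>\<^sup>2 * real N))"
    proof (rule integral_mono_AE)
      show "integrable (measure_pmf (decision_law M N \<phi> ?t))
        (\<lambda>(\<sigma>, a). \<Sum>b\<in>UNIV. \<Sum>s\<in>UNIV. real (action_count N \<sigma> a s b) * (?unused s b - ?null s))"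
        using integrable_action_count[where p = "decision_law M N \<phi> ?t" and N = N]
        by (auto simp: case_prod_unfold intro!: Bochner_Integration.integrable_sum integrable_mult_left)
      have "integrable (measure_pmf (decision_law M N \<phi> ?t)) (\<lambda>y. (?d (fst y))\<^sup>2)"
        by (rule integrable_pmf_bounded, rule fluid_deviation_squared_bounded)
      then show "integrable (measure_pmf (decision_law M N \<phi> ?t)) (\<lambda>y. (?d (fst y))\<^sup>2 / (\<delta>\<^sup>2 * real N))"
        by simp
    qed (use pointwise in \<open>simp add: AE_measure_pmf_iff\<close>)
    also have "\<dots> = measure_pmf.expectation (state_law M N \<phi> ?t) (\<lambda>\<sigma>. (?d \<sigma>)\<^sup>2) / (\<delta>\<^sup>2 * real N)"
      by (simp flip: decision_law_fst)
    also have "\<dots> \<le> C * real N / (\<delta>\<^sup>2 * real N)"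
      by (intro divide_right_mono C N \<phi>) simp
    finally show ?thesis using N0 \<delta> by (simp add: field_simps)
  qed
  then show ?thesis by blast
qed

lemma unused_mass_bound:
  assumes "Suc k \<in> epochs M"
  shows "\<exists>C. \<forall>N \<phi>. admissible_size M N \<longrightarrow> realizes M N (fluid_priority M x L N) \<phi> \<longrightarrow>
    unused_mass x (mean_occupation M N \<phi>) (Suc k) \<le> C / real N"
  using assms
proof (induction k)
  case 0
  have T: "1 \<le> horizon M" "1 \<in> epochs M" using 0 by (auto simp: epochs_def)
  have "(\<Sum>s\<in>null_states x (Suc 0). fluid_state (mean_occupation M N \<phi>) (Suc 0) s) = 0"
    if N: "admissible_size M N" and \<phi>: "realizes M N (fluid_priority M x L N) \<phi>" for N \<phi>
    using null_states_mass_first[OF feas mean_occupation_feasible[OF _ T(1) realized_relaxed[OF N \<phi>]] T(2)] N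
    by (simp add: admissible_size_def)
  then show ?case using unused_mass_step[OF 0] by fastforce
next
  case (Suc k)
  then have t: "Suc k \<in> epochs M" "Suc (Suc k) \<in> epochs M" "1 \<le> horizon M" by (auto simp: epochs_def)
  obtain C where C: "\<And>N \<phi>. admissible_size M N \<Longrightarrow> realizes M N (fluid_priority M x L N) \<phi> \<Longrightarrow>
    unused_mass x (mean_occupation M N \<phi>) (Suc k) \<le> C / real N"
    using Suc.IH[OF t(1)] by blast
  obtain D where D: "\<And>N \<phi>. admissible_size M N \<Longrightarrow> realizes M N (fluid_priority M x L N) \<phi> \<Longrightarrow>
    unused_mass x (mean_occupation M N \<phi>) (Suc (Suc k)) \<le>
      D / real N + (\<Sum>s\<in>null_states x (Suc (Suc k)). fluid_state (mean_occupation M N \<phi>) (Suc (Suc k)) s)"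
    using unused_mass_step[OF t(2)] by blast
  have "unused_mass x (mean_occupation M N \<phi>) (Suc (Suc k)) \<le> (C + D) / real N"
    if N: "admissible_size M N" and \<phi>: "realizes M N (fluid_priority M x L N) \<phi>" for N \<phi>
    using C[OF N \<phi>] D[OF N \<phi>] N
      null_states_mass_Suc[OF feas mean_occupation_feasible[OF _ t(3) realized_relaxed[OF N \<phi>]] t(1,2)]
    by (simp add: admissible_size_def add_divide_distrib)
  then show ?case by blast
qed

end
end

section \<open>Bounded loss\<close>

text \<open>
  The policy \<open>\<phi>\<close> serves to make the supremum range over a nonempty set.
\<close>
lemma relaxed_value_le:
  fixes M :: "'s::finite bandit"
  assumes "0 < N" and "1 \<le> horizon M" and "optimal_occupation M x" and "relaxed_policy M N \<phi>"
  shows "relaxed_value M N \<le> real N * occupation_reward M x"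
  unfolding relaxed_value_def
proof (rule cSUP_least)
  show "{\<phi>. relaxed_policy M N \<phi>} \<noteq> {}" using assms(4) by blast
  fix \<psi> assume "\<psi> \<in> {\<phi>. relaxed_policy M N \<phi>}"
  then have "feasible_occupation M (mean_occupation M N \<psi>)"
    using assms by (intro mean_occupation_feasible) auto
  then show "arm_value M N \<psi> \<le> real N * occupation_reward M x"
    using assms by (simp add: arm_value_eq_occupation_reward optimal_occupation_def)
qed

theorem theorem4:
  fixes M :: "'s::finite bandit"
    and x :: "'s occupation"
    and P :: "nat \<Rightarrow> 's \<Rightarrow> real"
    and L :: "nat \<Rightarrow> 's list"
  assumes "valid_ratios M"
    and "optimal_occupation M x"
    and "nondegenerate M x"
    and "\<forall>t\<in>epochs M. visiting_order (P t) (L t)"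
  shows "\<exists>m::real. \<forall>N. admissible_size M N \<longrightarrow>
    (\<forall>\<phi>. realizes M N (fluid_priority M x L N) \<phi> \<longrightarrow>
      relaxed_value M N - arm_value M N \<phi> \<le> m)"
proof (cases "horizon M = 0")
  case True
  then have "arm_value M N \<phi> = 0" "relaxed_policy M N \<phi>" for N \<phi>
    by (simp_all add: arm_value_def relaxed_policy_def epochs_def case_prod_unfold)
  then show ?thesis by (intro exI[of _ 0]) (simp add: relaxed_value_def)
next
  case False
  then have T: "1 \<le> horizon M" by simp
  have feas: "feasible_occupation M x" using assms(2) by (simp add: optimal_occupation_def)
  have "\<exists>C. \<forall>N \<phi>. admissible_size M N \<longrightarrow> realizes M N (fluid_priority M x L N) \<phi> \<longrightarrow>
      unused_mass x (mean_occupation M N \<phi>) t \<le> C / real N" if t: "t \<in> epochs M" for t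
  proof -
    obtain k where "t = Suc k" using t by (cases t) (auto simp: epochs_def)
    then show ?thesis using unused_mass_bound[OF assms(1) feas assms(4,3)] t by blast
  qed
  then obtain C where C: "\<And>t N \<phi>. t \<in> epochs M \<Longrightarrow> admissible_size M N \<Longrightarrow>
      realizes M N (fluid_priority M x L N) \<phi> \<Longrightarrow>
      unused_mass x (mean_occupation M N \<phi>) t \<le> C t / real N"
    by metis
  obtain K where K: "\<And>y B. feasible_occupation M y \<Longrightarrow> 0 \<le> B \<Longrightarrow>
      \<forall>t\<in>epochs M. \<forall>s a. x t s a = 0 \<longrightarrow> y t s a \<le> B \<Longrightarrow>
      occupation_reward M x - occupation_reward M y \<le> K * B"
    using optimal_occupation_sensitivity[OF assms(2) T] by blast
  define C' where "C' = (\<Sum>t\<in>epochs M. \<bar>C t\<bar>)"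
  have "relaxed_value M N - arm_value M N \<phi> \<le> K * C'"
    if N: "admissible_size M N" and \<phi>: "realizes M N (fluid_priority M x L N) \<phi>" for N \<phi>
  proof -
    let ?y = "mean_occupation M N \<phi>"
    have N0: "0 < N" using N by (simp add: admissible_size_def)
    have relaxed: "relaxed_policy M N \<phi>" by (rule realized_relaxed[OF assms(1) feas assms(4) N \<phi>])
    have y: "feasible_occupation M ?y" by (rule mean_occupation_feasible[OF N0 T relaxed])
    have "?y t s a \<le> C' / real N" if t: "t \<in> epochs M" and "x t s a = 0" for t s a
    proof -
      have nonneg: "0 \<le> ?y t s a" for s a
        using y t by (simp add: feasible_occupation_def)
      have "?y t s a = of_bool (x t s a = 0) * ?y t s a" using that by simp
      also have "\<dots> \<le> (\<Sum>a\<in>UNIV. of_bool (x t s a = 0) * ?y t s a)"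
        by (rule member_le_sum) (use nonneg in auto)
      also have "\<dots> \<le> unused_mass x ?y t"
        unfolding unused_mass_def
        by (rule member_le_sum[where f = "\<lambda>s. \<Sum>a\<in>UNIV. of_bool (x t s a = 0) * ?y t s a"])
          (use nonneg in \<open>auto intro!: sum_nonneg\<close>)
      also have "\<dots> \<le> C t / real N" by (rule C[OF t N \<phi>])
      also have "\<dots> \<le> C' / real N"
      proof (rule divide_right_mono)
        have "\<bar>C t\<bar> \<le> C'" unfolding C'_def
          by (rule member_le_sum) (use t in \<open>auto simp: epochs_def\<close>)
        then show "C t \<le> C'" by linarith
      qed simp
      finally show ?thesis .
    qed
    then have "occupation_reward M x - occupation_reward M ?y \<le> K * (C' / real N)"
      by (intro K y) (auto simp: C'_def intro!: sum_nonneg divide_nonneg_nonneg)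
    then have "real N * (occupation_reward M x - occupation_reward M ?y) \<le> real N * (K * (C' / real N))"
      by (rule mult_left_mono) simp
    then show ?thesis
      using relaxed_value_le[OF N0 T assms(2) relaxed] N0
      by (simp add: arm_value_eq_occupation_reward right_diff_distrib)
  qed
  then show ?thesis by blast
qed

end
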